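(* Let $X, d$ be a continuous quasi-metric space, $\alpha \in \mathbb{R}_+$, and $a \in \mathbb{R}_+$, $a > 0$. Let $\rho_\alpha$ be the map $f \in L_\alpha (X, d) \mapsto f^{(\alpha)} \in \mathcal{L}_\alpha (X, d)$. Then: (1) $\rho_\alpha$ is continuous from $L_\alpha (X, d)$ to $\mathcal{L}_\alpha (X, d)$ (resp., from $L_\alpha^a (X, d)$ to $\mathcal{L}_\alpha^a (X, d)$), both spaces being equipped with the topology of pointwise convergence; (2) $\mathcal{L}_\alpha (X, d)$ is a retract of $L_\alpha (X, d)$ (resp., $\mathcal{L}_\alpha^a (X, d)$ is a retract of $L_\alpha^a (X, d)$), with $\rho_\alpha$ as retraction and inclusion as section, both spaces again having the topology of pointwise convergence; (3) $\mathcal{L}_\alpha (X, d)$ and $\mathcal{L}_\alpha^a (X, d)$, with the topology of pointwise convergence, are stably compact; (4) if $X, d$ is also Yoneda-complete, then $\mathcal{L}_\alpha (X, d)$ and $\mathcal{L}_\alpha^a (X, d)$ are stably compact in the subspace topology of the Scott topology on $\mathcal{L} X$.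
   Context: $\mathbb{R}_+=[0,+\infty)$. A quasi-metric on $X$ is a map $d \colon X \times X \to [0,+\infty]$ with $d(x,x)=0$, the triangle inequality, and $d(x,y)=d(y,x)=0 \Rightarrow x=y$. Formal balls are pairs $(x,r)$, $x\in X$, $r\in \mathbb{R}_+$, ordered by $(x,r) \leq^{d^+} (y,s)$ iff $d(x,y) \leq r-s$; they form the poset $\mathbf{B}(X,d)$, with its Scott topology. $X$ is given the $d$-Scott topology, the coarsest one making $x \mapsto (x,0) \in \mathbf{B}(X,d)$ continuous. $X,d$ is standard iff for every directed family $(x_i,r_i)_{i\in I}$ of formal balls and every $s\in\mathbb{R}_+$, $(x_i,r_i)_{i\in I}$ has a supremum iff $(x_i,r_i+s)_{i\in I}$ has one. $X,d$ is continuous iff it is standard and $\mathbf{B}(X,d)$ is a continuous poset. It is Yoneda-complete iff $\mathbf{B}(X,d)$ is a dcpo. $[0,+\infty]$ carries the quasi-metric $\mathsf{d}_{\mathbb R}$ with $\mathsf{d}_{\mathbb R}(x,y)=0$ if $x \leq y$, $\mathsf{d}_{\mathbb R}(+\infty,y)=+\infty$ if $y\neq+\infty$, and $\mathsf{d}_{\mathbb R}(x,y)=x-y$ if $+\infty > x>y$. A map $f \colon X,d \to Y,\partial$ is $\alpha$-Lipschitz iff $\partial(f(x),f(y)) \leq \alpha d(x,y)$ for all $x,y$ (with $0\cdot(+\infty)=0$), and $\alpha$-Lipschitz continuous iff $(x,r) \mapsto (f(x),\alpha r)$ is Scott-continuous from $\mathbf{B}(X,d)$ to $\mathbf{B}(Y,\partial)$.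 $\mathcal{L} X$ is the set of lower semicontinuous maps from $X$ to $[0,+\infty]$, with the Scott topology of the pointwise ordering. $L_\alpha(X,d)$ (resp. $\mathcal{L}_\alpha(X,d) \subseteq \mathcal{L} X$) is the set of $\alpha$-Lipschitz (resp. $\alpha$-Lipschitz continuous) maps from $X,d$ to $[0,+\infty],\mathsf{d}_{\mathbb R}$; $L_\alpha^a(X,d)$ and $\mathcal{L}_\alpha^a(X,d)$ are the respective subsets of maps bounded above by $\alpha a$. For $f \in L_\alpha(X,d)$, $f^{(\alpha)}$ denotes the (pointwise) largest $\alpha$-Lipschitz continuous map below $f$, which exists. The topology of pointwise convergence has the sets $\{f \mid f(x) > r\}$, $x \in X$, $r \in \mathbb{R}_+$, as subbase. A stably compact space is a sober, locally compact, compact space in which the intersection of any two compact saturated subsets is compact (compactness does not include any separation axiom).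
   Formalization: The α-Lipschitz continuous maps are also required to be α-Lipschitz; this is automatic for α > 0, but for α = 0 (with 0·∞ = 0) it is needed, since otherwise the inclusion into L_0 can fail, e.g. for two points at infinite distance from each other. *)

theory Defs
  imports "HOL-Analysis.Analysis"
begin

section \<open>Posets and the Scott topology\<close>

text \<open>A poset is a carrier \<open>P\<close> with a relation \<open>le\<close>, which only matters on \<open>P\<close>.
  Suprema are taken in \<open>P\<close>.  Directed families enter through their (nonempty) range only.\<close>

definition poset_on :: "'b set \<Rightarrow> ('b \<Rightarrow> 'b \<Rightarrow> bool) \<Rightarrow> bool" where
  "poset_on P le \<longleftrightarrow> reflp_on P le \<and> transp_on P le \<and> antisymp_on P le"

definition directed_in :: "'b set \<Rightarrow> ('b \<Rightarrow> 'b \<Rightarrow> bool) \<Rightarrow> 'b set \<Rightarrow> bool" where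
  "directed_in P le D \<longleftrightarrow> D \<subseteq> P \<and> D \<noteq> {} \<and> (\<forall>x\<in>D. \<forall>y\<in>D. \<exists>z\<in>D. le x z \<and> le y z)"

definition is_sup_in :: "'b set \<Rightarrow> ('b \<Rightarrow> 'b \<Rightarrow> bool) \<Rightarrow> 'b set \<Rightarrow> 'b \<Rightarrow> bool" where
  "is_sup_in P le D u \<longleftrightarrow>
     u \<in> P \<and> (\<forall>x\<in>D. le x u) \<and> (\<forall>v\<in>P. (\<forall>x\<in>D. le x v) \<longrightarrow> le u v)"

definition dcpo_on :: "'b set \<Rightarrow> ('b \<Rightarrow> 'b \<Rightarrow> bool) \<Rightarrow> bool" where
  "dcpo_on P le \<longleftrightarrow>
     poset_on P le \<and> (\<forall>D. directed_in P le D \<longrightarrow> (\<exists>u. is_sup_in P le D u))"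

definition way_below :: "'b set \<Rightarrow> ('b \<Rightarrow> 'b \<Rightarrow> bool) \<Rightarrow> 'b \<Rightarrow> 'b \<Rightarrow> bool" where
  "way_below P le x y \<longleftrightarrow>
     (\<forall>D u. directed_in P le D \<and> is_sup_in P le D u \<and> le y u \<longrightarrow> (\<exists>z\<in>D. le x z))"

definition continuous_poset_on :: "'b set \<Rightarrow> ('b \<Rightarrow> 'b \<Rightarrow> bool) \<Rightarrow> bool" where
  "continuous_poset_on P le \<longleftrightarrow>
     poset_on P le \<and>
     (\<forall>x\<in>P. directed_in P le {y\<in>P. way_below P le y x} \<and>
             is_sup_in P le {y\<in>P. way_below P le y x} x)"

definition scott_open :: "'b set \<Rightarrow> ('b \<Rightarrow> 'b \<Rightarrow> bool) \<Rightarrow> 'b set \<Rightarrow> bool" where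
  "scott_open P le U \<longleftrightarrow>
     U \<subseteq> P \<and> (\<forall>x\<in>U. \<forall>y\<in>P. le x y \<longrightarrow> y \<in> U) \<and>
     (\<forall>D u. directed_in P le D \<and> is_sup_in P le D u \<and> u \<in> U \<longrightarrow> D \<inter> U \<noteq> {})"

definition scott_topology :: "'b set \<Rightarrow> ('b \<Rightarrow> 'b \<Rightarrow> bool) \<Rightarrow> 'b topology" where
  "scott_topology P le = topology (scott_open P le)"

lemma istopology_scott_open: "istopology (scott_open P le)"
  unfolding istopology_def
proof (intro conjI allI impI)
  fix S T assume S: "scott_open P le S" and T: "scott_open P le T"
  have "D \<inter> (S \<inter> T) \<noteq> {}"
    if D: "directed_in P le D" and u: "is_sup_in P le D u" "u \<in> S \<inter> T" for D u
  proof -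
    obtain x where x: "x \<in> D" "x \<in> S"
      using S D u unfolding scott_open_def by blast
    obtain y where y: "y \<in> D" "y \<in> T"
      using T D u unfolding scott_open_def by blast
    obtain z where z: "z \<in> D" "le x z" "le y z" "z \<in> P"
      using D x y unfolding directed_in_def by blast
    then have "z \<in> S" "z \<in> T"
      using S T x y unfolding scott_open_def by blast+
    with z show ?thesis by blast
  qed
  then show "scott_open P le (S \<inter> T)"
    using S T unfolding scott_open_def by (metis IntE IntI le_infI1)
next
  fix \<K> assume K: "\<forall>K\<in>\<K>. scott_open P le K"
  then have "D \<inter> \<Union>\<K> \<noteq> {}"
    if "directed_in P le D" "is_sup_in P le D u" "u \<in> \<Union>\<K>" for D u
    using that unfolding scott_open_def by (metis Int_emptyI Union_iff disjoint_iff)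
  moreover have "\<Union>\<K> \<subseteq> P" "\<forall>x\<in>\<Union>\<K>. \<forall>y\<in>P. le x y \<longrightarrow> y \<in> \<Union>\<K>"
    using K unfolding scott_open_def by blast+
  ultimately show "scott_open P le (\<Union>\<K>)"
    unfolding scott_open_def by blast
qed

lemma openin_scott_topology [simp]: "openin (scott_topology P le) = scott_open P le"
  unfolding scott_topology_def by (rule topology_inverse'[OF istopology_scott_open])

lemma topspace_scott_topology [simp]: "topspace (scott_topology P le) = P"
proof -
  have "scott_open P le P"
    unfolding scott_open_def directed_in_def by blast
  then show ?thesis
    unfolding topspace_def by (auto simp: scott_open_def)
qed

definition scott_continuous ::
    "'b set \<Rightarrow> ('b \<Rightarrow> 'b \<Rightarrow> bool) \<Rightarrow> 'c set \<Rightarrow> ('c \<Rightarrow> 'c \<Rightarrow> bool) \<Rightarrow> ('b \<Rightarrow> 'c) \<Rightarrow> bool" where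
  "scott_continuous P le Q le' f \<longleftrightarrow>
     f \<in> P \<rightarrow> Q \<and> monotone_on P le le' f \<and>
     (\<forall>D u. directed_in P le D \<and> is_sup_in P le D u \<longrightarrow> is_sup_in Q le' (f ` D) (f u))"

lemma scott_continuous_iff_continuous_map:
  assumes P: "poset_on P le" and Q: "poset_on Q le'"
  shows "scott_continuous P le Q le' f \<longleftrightarrow>
         continuous_map (scott_topology P le) (scott_topology Q le') f"
proof
  assume f: "scott_continuous P le Q le' f"
  have "scott_open P le {x \<in> P. f x \<in> U}" if U: "scott_open Q le' U" for U
    unfolding scott_open_def
  proof (intro conjI ballI allI impI)
    fix x y assume "x \<in> {x \<in> P. f x \<in> U}" "y \<in> P" "le x y"
    then show "y \<in> {x \<in> P. f x \<in> U}"
      using f U unfolding scott_continuous_def scott_open_def monotone_on_def by blast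
  next
    fix D u assume D: "directed_in P le D \<and> is_sup_in P le D u \<and> u \<in> {x \<in> P. f x \<in> U}"
    have "directed_in Q le' (f ` D)"
      unfolding directed_in_def
    proof (intro conjI ballI)
      show "f ` D \<subseteq> Q" "f ` D \<noteq> {}"
        using D f unfolding directed_in_def scott_continuous_def by blast+
      fix a b assume "a \<in> f ` D" "b \<in> f ` D"
      then obtain x y where "x \<in> D" "y \<in> D" "a = f x" "b = f y" by blast
      moreover then obtain z where z: "z \<in> D" "le x z" "le y z"
        using D unfolding directed_in_def by blast
      moreover have "x \<in> P" "y \<in> P" "z \<in> P"
        using D \<open>x \<in> D\<close> \<open>y \<in> D\<close> \<open>z \<in> D\<close> unfolding directed_in_def by blast+
      moreover have "monotone_on P le le' f"
        using f unfolding scott_continuous_def by blast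
      ultimately have "le' a (f z)" "le' b (f z)"
        by (simp_all add: monotone_onD)
      with z show "\<exists>c\<in>f ` D. le' a c \<and> le' b c" by blast
    qed
    moreover have "is_sup_in Q le' (f ` D) (f u)" "f u \<in> U"
      using D f unfolding scott_continuous_def by blast+
    ultimately have "f ` D \<inter> U \<noteq> {}"
      using U unfolding scott_open_def by blast
    moreover have "D \<subseteq> P" using D unfolding directed_in_def by blast
    ultimately show "D \<inter> {x \<in> P. f x \<in> U} \<noteq> {}" by blast
  qed auto
  then show "continuous_map (scott_topology P le) (scott_topology Q le') f"
    using f unfolding continuous_map_def scott_continuous_def by auto
next
  assume f: "continuous_map (scott_topology P le) (scott_topology Q le') f"
  have fPQ: "f \<in> P \<rightarrow> Q" using f unfolding continuous_map_def by simp
  have pre: "scott_open P le {x \<in> P. f x \<in> U}" if "scott_open Q le' U" for U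
    using f that unfolding continuous_map_def by simp
  have compl: "scott_open Q le' {w \<in> Q. \<not> le' w v}" if v: "v \<in> Q" for v
    unfolding scott_open_def
  proof (intro conjI ballI allI impI)
    fix x y assume "x \<in> {w \<in> Q. \<not> le' w v}" "y \<in> Q" "le' x y"
    then show "y \<in> {w \<in> Q. \<not> le' w v}"
      using Q v unfolding poset_on_def transp_on_def by blast
  next
    fix D u assume "directed_in Q le' D \<and> is_sup_in Q le' D u \<and> u \<in> {w \<in> Q. \<not> le' w v}"
    then show "D \<inter> {w \<in> Q. \<not> le' w v} \<noteq> {}"
      using v unfolding directed_in_def is_sup_in_def by blast
  qed auto
  have refl: "le' w w" if "w \<in> Q" for w
    using Q that unfolding poset_on_def reflp_on_def by blast
  have mono: "monotone_on P le le' f"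
  proof (rule monotone_onI, rule ccontr)
    fix x y assume xy: "x \<in> P" "y \<in> P" "le x y" "\<not> le' (f x) (f y)"
    have "f x \<in> Q" "f y \<in> Q" using fPQ xy by auto
    then have "x \<in> {z \<in> P. f z \<in> {w \<in> Q. \<not> le' w (f y)}}" using xy by blast
    then have "y \<in> {z \<in> P. f z \<in> {w \<in> Q. \<not> le' w (f y)}}"
      using pre[OF compl[OF \<open>f y \<in> Q\<close>]] xy unfolding scott_open_def by blast
    then show False using refl by blast
  qed
  have "is_sup_in Q le' (f ` D) (f u)"
    if D: "directed_in P le D" and u: "is_sup_in P le D u" for D u
    unfolding is_sup_in_def
  proof (intro conjI ballI impI)
    have uP: "u \<in> P" using u unfolding is_sup_in_def by blast
    then show fu: "f u \<in> Q" using fPQ by auto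
    show "le' y (f u)" if "y \<in> f ` D" for y
      using that u D uP mono unfolding is_sup_in_def directed_in_def monotone_on_def by blast
    fix v assume v: "v \<in> Q" and ub: "\<forall>y\<in>f ` D. le' y v"
    show "le' (f u) v"
    proof (rule ccontr)
      assume "\<not> le' (f u) v"
      then have "u \<in> {z \<in> P. f z \<in> {w \<in> Q. \<not> le' w v}}" using uP fu by blast
      then have "D \<inter> {z \<in> P. f z \<in> {w \<in> Q. \<not> le' w v}} \<noteq> {}"
        using pre[OF compl[OF v]] D u unfolding scott_open_def by blast
      then show False using ub by blast
    qed
  qed
  then show "scott_continuous P le Q le' f"
    using fPQ mono unfolding scott_continuous_def by blast
qed


section \<open>Quasi-metric spaces and formal balls\<close>

definition quasi_metric_on :: "'a set \<Rightarrow> ('a \<Rightarrow> 'a \<Rightarrow> ennreal) \<Rightarrow> bool" where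
  "quasi_metric_on X d \<longleftrightarrow>
     (\<forall>x\<in>X. d x x = 0) \<and>
     (\<forall>x\<in>X. \<forall>y\<in>X. \<forall>z\<in>X. d x z \<le> d x y + d y z) \<and>
     (\<forall>x\<in>X. \<forall>y\<in>X. d x y = 0 \<and> d y x = 0 \<longrightarrow> x = y)"

definition formal_balls :: "'a set \<Rightarrow> ('a \<times> real) set" where
  "formal_balls X = X \<times> {0..}"

text \<open>The conjunct \<open>s \<le> r\<close> is needed because \<open>ennreal\<close> maps negative numbers to \<open>0\<close>.\<close>

definition ball_le :: "('a \<Rightarrow> 'a \<Rightarrow> ennreal) \<Rightarrow> 'a \<times> real \<Rightarrow> 'a \<times> real \<Rightarrow> bool" where
  "ball_le d = (\<lambda>(x, r) (y, s). s \<le> r \<and> d x y \<le> ennreal (r - s))"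

definition d_scott_topology :: "'a set \<Rightarrow> ('a \<Rightarrow> 'a \<Rightarrow> ennreal) \<Rightarrow> 'a topology" where
  "d_scott_topology X d =
     pullback_topology X (\<lambda>x. (x, 0)) (scott_topology (formal_balls X) (ball_le d))"

definition standard_qms :: "'a set \<Rightarrow> ('a \<Rightarrow> 'a \<Rightarrow> ennreal) \<Rightarrow> bool" where
  "standard_qms X d \<longleftrightarrow>
     (\<forall>D s. directed_in (formal_balls X) (ball_le d) D \<and> 0 \<le> s \<longrightarrow>
        ((\<exists>u. is_sup_in (formal_balls X) (ball_le d) D u) \<longleftrightarrow>
         (\<exists>u. is_sup_in (formal_balls X) (ball_le d) ((\<lambda>(x, r). (x, r + s)) ` D) u)))"

definition continuous_qms :: "'a set \<Rightarrow> ('a \<Rightarrow> 'a \<Rightarrow> ennreal) \<Rightarrow> bool" where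
  "continuous_qms X d \<longleftrightarrow>
     standard_qms X d \<and> continuous_poset_on (formal_balls X) (ball_le d)"

definition Yoneda_complete :: "'a set \<Rightarrow> ('a \<Rightarrow> 'a \<Rightarrow> ennreal) \<Rightarrow> bool" where
  "Yoneda_complete X d \<longleftrightarrow> dcpo_on (formal_balls X) (ball_le d)"

lemma poset_on_formal_balls:
  assumes "quasi_metric_on X d"
  shows "poset_on (formal_balls X) (ball_le d)"
  unfolding poset_on_def
proof (intro conjI)
  show "reflp_on (formal_balls X) (ball_le d)"
    using assms unfolding quasi_metric_on_def
    by (auto simp: reflp_on_def formal_balls_def ball_le_def)
  show "transp_on (formal_balls X) (ball_le d)"
  proof (rule transp_onI)
    fix b c e assume b: "b \<in> formal_balls X" "c \<in> formal_balls X" "e \<in> formal_balls X"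
      and le: "ball_le d b c" "ball_le d c e"
    obtain x r y s z t where eq: "b = (x, r)" "c = (y, s)" "e = (z, t)"
      by (metis surj_pair)
    have "d x z \<le> d x y + d y z"
      using assms b unfolding quasi_metric_on_def formal_balls_def eq by blast
    also have "\<dots> \<le> ennreal (r - s) + ennreal (s - t)"
      using le unfolding ball_le_def eq by (auto intro: add_mono)
    also have "\<dots> = ennreal (r - t)"
      using le unfolding ball_le_def eq by (simp flip: ennreal_plus)
    finally show "ball_le d b e"
      using le unfolding ball_le_def eq by auto
  qed
  show "antisymp_on (formal_balls X) (ball_le d)"
  proof (rule antisymp_onI)
    fix b c assume b: "b \<in> formal_balls X" "c \<in> formal_balls X"
      and le: "ball_le d b c" "ball_le d c b"
    obtain x r y s where eq: "b = (x, r)" "c = (y, s)"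
      by (metis surj_pair)
    have "r = s" using le unfolding ball_le_def eq by auto
    then have "d x y = 0" "d y x = 0" using le unfolding ball_le_def eq by auto
    then have "x = y"
      using assms b unfolding quasi_metric_on_def formal_balls_def eq by blast
    with \<open>r = s\<close> show "b = c" by (simp add: eq)
  qed
qed

text \<open>In \<open>ennreal\<close>, \<open>0 * \<infinity> = 0\<close>, which is the convention used in the Lipschitz condition.\<close>

definition lipschitz_qm :: "'a set \<Rightarrow> ('a \<Rightarrow> 'a \<Rightarrow> ennreal) \<Rightarrow> 'b set \<Rightarrow> ('b \<Rightarrow> 'b \<Rightarrow> ennreal) \<Rightarrow>
    real \<Rightarrow> ('a \<Rightarrow> 'b) \<Rightarrow> bool" where
  "lipschitz_qm X d Y e \<alpha> f \<longleftrightarrow>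
     f \<in> X \<rightarrow> Y \<and> (\<forall>x\<in>X. \<forall>y\<in>X. e (f x) (f y) \<le> ennreal \<alpha> * d x y)"

definition lipschitz_continuous_qm :: "'a set \<Rightarrow> ('a \<Rightarrow> 'a \<Rightarrow> ennreal) \<Rightarrow> 'b set \<Rightarrow>
    ('b \<Rightarrow> 'b \<Rightarrow> ennreal) \<Rightarrow> real \<Rightarrow> ('a \<Rightarrow> 'b) \<Rightarrow> bool" where
  "lipschitz_continuous_qm X d Y e \<alpha> f \<longleftrightarrow>
     scott_continuous (formal_balls X) (ball_le d) (formal_balls Y) (ball_le e)
       (\<lambda>(x, r). (f x, \<alpha> * r))"

lemma lipschitz_continuous_qmD:
  assumes "lipschitz_continuous_qm X d Y e \<alpha> f"
  shows "\<And>x r. (x, r) \<in> formal_balls X \<Longrightarrow> (f x, \<alpha> * r) \<in> formal_balls Y"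
    and "\<And>x r y s. \<lbrakk>(x, r) \<in> formal_balls X; (y, s) \<in> formal_balls X; ball_le d (x, r) (y, s)\<rbrakk>
           \<Longrightarrow> ball_le e (f x, \<alpha> * r) (f y, \<alpha> * s)"
    and "\<And>D y s. \<lbrakk>directed_in (formal_balls X) (ball_le d) D;
             is_sup_in (formal_balls X) (ball_le d) D (y, s)\<rbrakk>
           \<Longrightarrow> is_sup_in (formal_balls Y) (ball_le e) ((\<lambda>(x, r). (f x, \<alpha> * r)) ` D) (f y, \<alpha> * s)"
proof -
  let ?g = "\<lambda>(x, r). (f x, \<alpha> * r)"
  have maps: "?g \<in> formal_balls X \<rightarrow> formal_balls Y"
    and mono: "monotone_on (formal_balls X) (ball_le d) (ball_le e) ?g"
    and sup: "\<And>D u. directed_in (formal_balls X) (ball_le d) D \<Longrightarrow>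
           is_sup_in (formal_balls X) (ball_le d) D u \<Longrightarrow>
           is_sup_in (formal_balls Y) (ball_le e) (?g ` D) (?g u)"
    using assms unfolding lipschitz_continuous_qm_def scott_continuous_def by blast+
  show "(f x, \<alpha> * r) \<in> formal_balls Y" if "(x, r) \<in> formal_balls X" for x r
    using PiE[OF maps, of "(x, r)"] that by auto
  show "ball_le e (f x, \<alpha> * r) (f y, \<alpha> * s)"
    if "(x, r) \<in> formal_balls X" "(y, s) \<in> formal_balls X" "ball_le d (x, r) (y, s)" for x r y s
    using monotone_onD[OF mono that] by simp
  show "is_sup_in (formal_balls Y) (ball_le e) (?g ` D) (f y, \<alpha> * s)"
    if "directed_in (formal_balls X) (ball_le d) D"
      "is_sup_in (formal_balls X) (ball_le d) D (y, s)" for D y s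
    using sup[OF that] by simp
qed

lemma lipschitz_continuous_imp_lipschitz:
  assumes "0 < \<alpha>" and f: "lipschitz_continuous_qm X d Y e \<alpha> f"
  shows "lipschitz_qm X d Y e \<alpha> f"
  unfolding lipschitz_qm_def
proof (intro conjI ballI)
  show "f \<in> X \<rightarrow> Y"
  proof
    fix x assume "x \<in> X"
    then have "(x, 0::real) \<in> formal_balls X" by (simp add: formal_balls_def)
    from lipschitz_continuous_qmD(1)[OF f this] have "(f x, \<alpha> * 0) \<in> formal_balls Y" .
    then show "f x \<in> Y" by (simp add: formal_balls_def)
  qed
  fix x y assume xy: "x \<in> X" "y \<in> X"
  show "e (f x) (f y) \<le> ennreal \<alpha> * d x y"
  proof (cases "d x y")
    case (real r)
    then have "(x, r) \<in> formal_balls X" "(y, 0::real) \<in> formal_balls X" "ball_le d (x, r) (y, 0)"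
      using xy by (auto simp: formal_balls_def ball_le_def)
    from lipschitz_continuous_qmD(2)[OF f this]
    have "ball_le e (f x, \<alpha> * r) (f y, \<alpha> * 0)" .
    then show ?thesis
      using real assms by (simp add: ball_le_def ennreal_mult)
  next
    case top
    then show ?thesis using assms by (simp add: ennreal_mult_top)
  qed
qed


section \<open>Spaces of maps to the extended non-negative reals\<close>

definition dR :: "ennreal \<Rightarrow> ennreal \<Rightarrow> ennreal" where
  "dR x y = (if x \<le> y then 0 else if x = \<infinity> then \<infinity> else x - y)"

lemma dR_le_iff: "dR x y \<le> ennreal c \<longleftrightarrow> x \<le> y + ennreal c"
proof (cases "x \<le> y")
  case True
  then show ?thesis by (simp add: dR_def add_increasing2)
next
  case False
  show ?thesis
  proof (cases "x = \<infinity>")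
    case True
    with False show ?thesis by (auto simp: dR_def top_unique)
  next
    case xfin: False
    with False show ?thesis by (simp add: dR_def ennreal_minus_le_iff top_unique)
  qed
qed

lemma quasi_metric_on_dR: "quasi_metric_on UNIV dR"
proof -
  have "dR x z \<le> dR x y + dR y z" for x y z
    by (cases x; cases y; cases z)
      (auto simp: dR_def top_unique ennreal_minus simp flip: ennreal_plus)
  moreover have "dR x x = 0" for x
    by (simp add: dR_def)
  moreover have "x = y" if "dR x y = 0" "dR y x = 0" for x y
    using that dR_le_iff[of x y 0] dR_le_iff[of y x 0] by simp
  ultimately show ?thesis
    unfolding quasi_metric_on_def by blast
qed

text \<open>Maps with domain \<open>X\<close> are represented by functions that are extensional on \<open>X\<close>.\<close>

definition LSC :: "'a set \<Rightarrow> ('a \<Rightarrow> 'a \<Rightarrow> ennreal) \<Rightarrow> ('a \<Rightarrow> ennreal) set" where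
  "LSC X d = {f \<in> extensional X. \<forall>r. openin (d_scott_topology X d) {x\<in>X. r < f x}}"

definition Lip :: "'a set \<Rightarrow> ('a \<Rightarrow> 'a \<Rightarrow> ennreal) \<Rightarrow> real \<Rightarrow> ('a \<Rightarrow> ennreal) set" where
  "Lip X d \<alpha> = {f \<in> extensional X. lipschitz_qm X d UNIV dR \<alpha> f}"

text \<open>For \<open>\<alpha> > 0\<close>, membership in \<open>Lip X d \<alpha>\<close> is implied by Lipschitz continuity
  (\<open>lipschitz_continuous_imp_lipschitz\<close>).  For \<open>\<alpha> = 0\<close> it is not, since the convention
  \<open>0 * \<infinity> = 0\<close> makes \<open>0\<close>-Lipschitz maps constant even between points at infinite distance,
  whereas \<open>(x, r) \<mapsto> (f x, 0)\<close> may be Scott-continuous for non-constant \<open>f\<close>.  Requiring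
  membership makes \<open>Lip_cont X d \<alpha>\<close> a subset of \<open>Lip X d \<alpha>\<close> for every \<open>\<alpha> \<ge> 0\<close>.\<close>

definition Lip_cont :: "'a set \<Rightarrow> ('a \<Rightarrow> 'a \<Rightarrow> ennreal) \<Rightarrow> real \<Rightarrow> ('a \<Rightarrow> ennreal) set" where
  "Lip_cont X d \<alpha> = {f \<in> Lip X d \<alpha>. lipschitz_continuous_qm X d UNIV dR \<alpha> f}"

lemma Lip_cont_eq:
  assumes "0 < \<alpha>"
  shows "Lip_cont X d \<alpha> = {f \<in> extensional X. lipschitz_continuous_qm X d UNIV dR \<alpha> f}"
  using lipschitz_continuous_imp_lipschitz[OF assms] by (auto simp: Lip_cont_def Lip_def)

definition Lip_bdd :: "'a set \<Rightarrow> ('a \<Rightarrow> 'a \<Rightarrow> ennreal) \<Rightarrow> real \<Rightarrow> real \<Rightarrow> ('a \<Rightarrow> ennreal) set" where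
  "Lip_bdd X d \<alpha> a = {f \<in> Lip X d \<alpha>. \<forall>x\<in>X. f x \<le> ennreal (\<alpha> * a)}"

definition Lip_cont_bdd ::
    "'a set \<Rightarrow> ('a \<Rightarrow> 'a \<Rightarrow> ennreal) \<Rightarrow> real \<Rightarrow> real \<Rightarrow> ('a \<Rightarrow> ennreal) set" where
  "Lip_cont_bdd X d \<alpha> a = {f \<in> Lip_cont X d \<alpha>. \<forall>x\<in>X. f x \<le> ennreal (\<alpha> * a)}"

definition pointwise_le :: "'a set \<Rightarrow> ('a \<Rightarrow> ennreal) \<Rightarrow> ('a \<Rightarrow> ennreal) \<Rightarrow> bool" where
  "pointwise_le X f g \<longleftrightarrow> (\<forall>x\<in>X. f x \<le> g x)"

definition Lip_envelope ::
    "'a set \<Rightarrow> ('a \<Rightarrow> 'a \<Rightarrow> ennreal) \<Rightarrow> real \<Rightarrow> ('a \<Rightarrow> ennreal) \<Rightarrow> ('a \<Rightarrow> ennreal)" where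
  "Lip_envelope X d \<alpha> f =
     (THE g. g \<in> Lip_cont X d \<alpha> \<and> pointwise_le X g f \<and>
             (\<forall>h \<in> Lip_cont X d \<alpha>. pointwise_le X h f \<longrightarrow> pointwise_le X h g))"

text \<open>\<open>F\<close> itself has to be listed, as the other subbasic sets need not cover it
  (the zero map belongs to none of them).\<close>

definition pointwise_topology :: "'a set \<Rightarrow> ('a \<Rightarrow> ennreal) set \<Rightarrow> ('a \<Rightarrow> ennreal) topology" where
  "pointwise_topology X F =
     topology_generated_by
       (insert F {{f\<in>F. ennreal r < f x} | x r. x \<in> X \<and> 0 \<le> r})"

lemma topspace_pointwise_topology [simp]: "topspace (pointwise_topology X F) = F"
  unfolding pointwise_topology_def topology_generated_by_topspace by blast

definition LSC_scott :: "'a set \<Rightarrow> ('a \<Rightarrow> 'a \<Rightarrow> ennreal) \<Rightarrow> ('a \<Rightarrow> ennreal) topology" where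
  "LSC_scott X d = scott_topology (LSC X d) (pointwise_le X)"

text \<open>By the following inclusion, the subspaces of \<open>LSC_scott X d\<close> on \<open>Lip_cont X d \<alpha>\<close> and
  \<open>Lip_cont_bdd X d \<alpha> a\<close> have these sets as underlying sets.\<close>

lemma Lip_cont_subset_LSC:
  assumes "0 \<le> \<alpha>"
  shows "Lip_cont X d \<alpha> \<subseteq> LSC X d"
proof
  fix f assume f: "f \<in> Lip_cont X d \<alpha>"
  then have lc: "lipschitz_continuous_qm X d UNIV dR \<alpha> f"
    unfolding Lip_cont_def by simp
  have mono: "f x \<le> f y + ennreal (\<alpha> * s - \<alpha> * t)"
    if "x \<in> X" "y \<in> X" "0 \<le> s" "0 \<le> t" "ball_le d (x, s) (y, t)" for x y s t
  proof -
    have "ball_le dR (f x, \<alpha> * s) (f y, \<alpha> * t)"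
      using that by (intro lipschitz_continuous_qmD(2)[OF lc]) (simp_all add: formal_balls_def)
    then show ?thesis by (simp add: ball_le_def dR_le_iff)
  qed
  have "openin (d_scott_topology X d) {x\<in>X. r < f x}" for r
  proof -
    define U where "U = {(x, s) \<in> formal_balls X. r + ennreal (\<alpha> * s) < f x}"
    have "scott_open (formal_balls X) (ball_le d) U"
      unfolding scott_open_def
    proof (intro conjI ballI allI impI)
      fix b c assume bc: "b \<in> U" "c \<in> formal_balls X" "ball_le d b c"
      obtain x s y t where eq: "b = (x, s)" "c = (y, t)" by (metis surj_pair)
      have st: "x \<in> X" "y \<in> X" "0 \<le> s" "0 \<le> t" "t \<le> s" "r + ennreal (\<alpha> * s) < f x"
        using bc unfolding eq U_def formal_balls_def ball_le_def by auto
      have "r + ennreal (\<alpha> * t) < f y"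
      proof (rule ccontr)
        assume "\<not> r + ennreal (\<alpha> * t) < f y"
        then have "f y + ennreal (\<alpha> * s - \<alpha> * t) \<le>
            (r + ennreal (\<alpha> * t)) + ennreal (\<alpha> * s - \<alpha> * t)"
          by (intro add_right_mono) simp
        also have "\<dots> = r + ennreal (\<alpha> * s)"
          using st assms by (simp add: add.assoc mult_left_mono flip: ennreal_plus)
        finally show False
          using mono[of x y s t] st bc(3) unfolding eq by auto
      qed
      then show "c \<in> U" using bc(2) unfolding eq U_def by simp
    next
      fix D u assume D: "directed_in (formal_balls X) (ball_le d) D \<and>
        is_sup_in (formal_balls X) (ball_le d) D u \<and> u \<in> U"
      obtain y t where u: "u = (y, t)" by (metis surj_pair)
      have yt: "0 \<le> t" "r + ennreal (\<alpha> * t) < f y"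
        using D unfolding u U_def formal_balls_def by auto
      have sup: "is_sup_in (formal_balls UNIV) (ball_le dR) ((\<lambda>(x, r). (f x, \<alpha> * r)) ` D)
          (f y, \<alpha> * t)"
        using D unfolding u by (intro lipschitz_continuous_qmD(3)[OF lc]) auto
      show "D \<inter> U \<noteq> {}"
      proof
        assume DU: "D \<inter> U = {}"
        have "ball_le dR b (r, 0)" if bD: "b \<in> (\<lambda>(x, r). (f x, \<alpha> * r)) ` D" for b
        proof -
          obtain x s where b: "b = (f x, \<alpha> * s)" "(x, s) \<in> D" using bD by auto
          moreover have "(x, s) \<in> formal_balls X" using D b unfolding directed_in_def by blast
          ultimately show ?thesis
            using DU assms by (auto simp: U_def ball_le_def dR_le_iff formal_balls_def not_less)
        qed
        then have "ball_le dR (f y, \<alpha> * t) (r, 0)"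
          using sup unfolding is_sup_in_def by (auto simp: formal_balls_def)
        then show False using yt by (auto simp: ball_le_def dR_le_iff dest: leD)
      qed
    qed (auto simp: U_def)
    moreover have "{x\<in>X. r < f x} = (\<lambda>x. (x, 0)) -` U \<inter> X"
      by (auto simp: U_def formal_balls_def)
    ultimately show ?thesis
      unfolding d_scott_topology_def openin_pullback_topology by auto
  qed
  then show "f \<in> LSC X d"
    using f unfolding LSC_def Lip_cont_def Lip_def by blast
qed


section \<open>Stably compact spaces\<close>

definition irreducible_closedin :: "'b topology \<Rightarrow> 'b set \<Rightarrow> bool" where
  "irreducible_closedin T C \<longleftrightarrow>
     closedin T C \<and> C \<noteq> {} \<and>
     (\<forall>A B. closedin T A \<and> closedin T B \<and> C \<subseteq> A \<union> B \<longrightarrow> C \<subseteq> A \<or> C \<subseteq> B)"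

definition sober_space :: "'b topology \<Rightarrow> bool" where
  "sober_space T \<longleftrightarrow>
     (\<forall>C. irreducible_closedin T C \<longrightarrow> (\<exists>!x. x \<in> topspace T \<and> C = T closure_of {x}))"

definition saturatedin :: "'b topology \<Rightarrow> 'b set \<Rightarrow> bool" where
  "saturatedin T S \<longleftrightarrow> S \<subseteq> topspace T \<and> S = \<Inter>{U. openin T U \<and> S \<subseteq> U}"

text \<open>Without separation, local compactness means that every point has a base of compact
  neighbourhoods, which is stronger than \<open>locally_compact_space\<close>.\<close>

definition stably_compact_space :: "'b topology \<Rightarrow> bool" where
  "stably_compact_space T \<longleftrightarrow>
     sober_space T \<and> neighbourhood_base_of (compactin T) T \<and> compact_space T \<and>
     (\<forall>K L. compactin T K \<and> saturatedin T K \<and> compactin T L \<and> saturatedin T L \<longrightarrow>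
        compactin T (K \<inter> L))"

end

theory Submission
  imports Defs
begin

text \<open>In a standard space the way-below relation between formal balls is invariant under shifting
  both radii.  Hence \<open>sup {f y - \<alpha> s | (y, s) \<lless> (x, 0)}\<close> is Lipschitz continuous in \<open>x\<close>, so it is the
  envelope of \<open>f\<close> at \<open>x\<close>, and as a supremum it depends continuously on \<open>f\<close> for pointwise convergence.
  The Lipschitz maps are closed in the compact pospace \<open>[0, \<infinity>]\<^sup>X\<close>, hence stably compact, and stable
  compactness passes to retracts.  On Lipschitz continuous maps the Scott topology induces pointwise
  convergence, because they are directed suprema of step maps \<open>max q\<^sub>i 1[(y\<^sub>i, s\<^sub>i) \<lless> (x, 0)]\<close> that lie
  below every Lipschitz \<open>h\<close> with \<open>q\<^sub>i + \<alpha> s\<^sub>i < h y\<^sub>i\<close>.\<close>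

section \<open>Stably compact spaces\<close>

text \<open>The detour through all Lipschitz maps is forced: the Lipschitz continuous ones need not
  be closed in the cube. On {0, 1, ..., \<omega>}, with distance 0 upwards and infinite otherwise,
  the indicators of {n, ..., \<omega>} converge pointwise to that of {\<omega>}, which is not
  Scott-continuous. The formula for the envelope comes from the inequality
  \<open>f y \<le> f x + \<alpha> s\<close>, which holds for Lipschitz \<open>f\<close> whenever the
  ball (y, s) lies below (x, 0). So \<open>f y - \<alpha> s\<close> is a lower bound that the value
  at y imposes on \<open>f x\<close>. Over all balls below (x, 0) the supremum of these bounds is
  \<open>f x\<close> itself; over the balls way below, it becomes Scott-continuous, because the set
  of balls way above a given ball is Scott-open. The formula mentions centres of radius 0 only,
  whereas Lipschitz continuity concerns all balls (x, r); the shift of radii translates between the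
  two, and this is where standardness enters. For a closed set of the cube, the compact saturated
  sets of its pointwise topology are closed in the cube, so their intersections are compact.\<close>

text \<open>Irreducibility in terms of open sets: if two open sets meet \<open>C\<close> but their
  intersection does not, their complements cover \<open>C\<close>. An open \<open>V\<close> inside
  the intersection is asked for because the intersection of the empty family is
  \<open>UNIV\<close>.\<close>

lemma irreducible_closedin_meets_finite_Inter:
  assumes C: "irreducible_closedin T C" and "finite \<G>"
    and "\<And>U. U \<in> \<G> \<Longrightarrow> openin T U \<and> U \<inter> C \<noteq> {}"
  shows "\<exists>V. openin T V \<and> V \<inter> C \<noteq> {} \<and> V \<subseteq> \<Inter>\<G>"
  using assms(2,3)
proof (induction \<G> rule: finite_induct)
  case empty
  have "topspace T \<inter> C \<noteq> {}"
    using C closedin_subset unfolding irreducible_closedin_def by blast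
  then show ?case by (intro exI[of _ "topspace T"]) auto
next
  case (insert U \<G>)
  then obtain V where V: "openin T V" "V \<inter> C \<noteq> {}" "V \<subseteq> \<Inter>\<G>" by auto
  have U: "openin T U" "U \<inter> C \<noteq> {}" using insert.prems by auto
  have "U \<inter> V \<inter> C \<noteq> {}"
  proof
    assume "U \<inter> V \<inter> C = {}"
    moreover have "C \<subseteq> topspace T"
      using C closedin_subset unfolding irreducible_closedin_def by blast
    ultimately have "C \<subseteq> (topspace T - U) \<union> (topspace T - V)" by blast
    moreover have "closedin T (topspace T - U)" "closedin T (topspace T - V)"
      using U V by auto
    ultimately have "C \<subseteq> topspace T - U \<or> C \<subseteq> topspace T - V"
      using C unfolding irreducible_closedin_def by blast
    then show False using U V by blast
  qed
  then show ?case using U V by (intro exI[of _ "U \<inter> V"]) auto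
qed

text \<open>Makes the uniqueness half of sobriety applicable to points: in a sober space, points
  with equal closures are equal.\<close>

lemma irreducible_closedin_closure_of_singleton:
  assumes "x \<in> topspace T"
  shows "irreducible_closedin T (T closure_of {x})"
  unfolding irreducible_closedin_def
proof (intro conjI allI impI)
  show "T closure_of {x} \<noteq> {}" using assms closure_of_eq_empty[of "{x}" T] by auto
  fix A B assume AB: "closedin T A \<and> closedin T B \<and> T closure_of {x} \<subseteq> A \<union> B"
  have "x \<in> T closure_of {x}"
    using assms closure_of_subset[of "{x}" T] by auto
  then have "x \<in> A \<or> x \<in> B" using AB by auto
  then show "T closure_of {x} \<subseteq> A \<or> T closure_of {x} \<subseteq> B"
    using AB closure_of_minimal[of "{x}"] by (metis empty_subsetI insert_subset)
qed simp

text \<open>The closure of the image of \<open>C\<close> under \<open>s\<close> is irreducible,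
  since covers by closed sets pull back along \<open>s\<close>. If x is its generic point, then
  \<open>r x\<close> is generic for \<open>C\<close>.\<close>

lemma sober_space_retraction:
  assumes ret: "retraction_maps S T r s" and sober: "sober_space S"
  shows "sober_space T"
  unfolding sober_space_def
proof (intro allI impI)
  fix C assume C: "irreducible_closedin T C"
  have r: "continuous_map S T r" and s: "continuous_map T S s"
    and rs: "\<And>y. y \<in> topspace T \<Longrightarrow> r (s y) = y"
    using ret unfolding retraction_maps_def by auto
  have CT: "closedin T C" "C \<subseteq> topspace T" "C \<noteq> {}"
    using C closedin_subset unfolding irreducible_closedin_def by blast+
  have sC: "s ` C \<subseteq> topspace S"
    using CT continuous_map_image_subset_topspace[OF s] by blast
  have "irreducible_closedin S (S closure_of (s ` C))"
    unfolding irreducible_closedin_def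
  proof (intro conjI allI impI)
    show "S closure_of (s ` C) \<noteq> {}"
      using CT sC closure_of_subset by blast
    fix A B assume AB: "closedin S A \<and> closedin S B \<and> S closure_of (s ` C) \<subseteq> A \<union> B"
    then have "s ` C \<subseteq> A \<union> B" using closure_of_subset[OF sC] by blast
    then have "C \<subseteq> {y \<in> topspace T. s y \<in> A} \<union> {y \<in> topspace T. s y \<in> B}"
      using CT by blast
    moreover have "closedin T {y \<in> topspace T. s y \<in> A}" "closedin T {y \<in> topspace T. s y \<in> B}"
      using AB closedin_continuous_map_preimage[OF s] by blast+
    ultimately have "C \<subseteq> {y \<in> topspace T. s y \<in> A} \<or> C \<subseteq> {y \<in> topspace T. s y \<in> B}"
      using C unfolding irreducible_closedin_def by blast
    then have "s ` C \<subseteq> A \<or> s ` C \<subseteq> B" by blast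
    then show "S closure_of (s ` C) \<subseteq> A \<or> S closure_of (s ` C) \<subseteq> B"
      using AB closure_of_minimal by meson
  qed simp
  then obtain x where x: "x \<in> topspace S" "S closure_of (s ` C) = S closure_of {x}"
    using sober unfolding sober_space_def by meson
  have rx: "r x \<in> topspace T"
    using r x unfolding continuous_map_def by auto
  have pre: "closedin S {z \<in> topspace S. r z \<in> A}" if "closedin T A" for A
    using closedin_continuous_map_preimage[OF r that] .
  have "S closure_of (s ` C) \<subseteq> {z \<in> topspace S. r z \<in> C}"
    using sC CT rs by (intro closure_of_minimal pre) auto
  moreover have "x \<in> S closure_of (s ` C)"
    using x closure_of_subset[of "{x}" S] by auto
  ultimately have "T closure_of {r x} \<subseteq> C"
    using CT by (intro closure_of_minimal) auto
  moreover have "S closure_of {x} \<subseteq> {z \<in> topspace S. r z \<in> T closure_of {r x}}"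
    using x rx closure_of_subset[of "{r x}" T] by (intro closure_of_minimal pre) auto
  then have "s ` C \<subseteq> {z \<in> topspace S. r z \<in> T closure_of {r x}}"
    using closure_of_subset[OF sC] x by blast
  then have "C \<subseteq> T closure_of {r x}"
    using rs CT by (force simp: image_subset_iff)
  ultimately have gen: "C = T closure_of {r x}" by blast
  \<comment> \<open>Continuity makes \<open>s\<close> monotone for the specialization preorder. Two
    generic points of \<open>C\<close> thus have images with the same closure in \<open>S\<close>,
    and these images are equal by sobriety.\<close>
  have le: "s y \<in> S closure_of {s y'}"
    if "y \<in> T closure_of {y'}" "y' \<in> topspace T" for y y'
  proof -
    have "s y' \<in> topspace S" using s that unfolding continuous_map_def by auto
    then have "y' \<in> {z \<in> topspace T. s z \<in> S closure_of {s y'}}"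
      using that closure_of_subset[of "{s y'}" S] by auto
    then have "T closure_of {y'} \<subseteq> {z \<in> topspace T. s z \<in> S closure_of {s y'}}"
      using closedin_continuous_map_preimage[OF s closedin_closure_of]
      by (intro closure_of_minimal) auto
    then show ?thesis using that by auto
  qed
  show "\<exists>!y. y \<in> topspace T \<and> C = T closure_of {y}"
  proof (rule ex1I[of _ "r x"])
    show "r x \<in> topspace T \<and> C = T closure_of {r x}" using rx gen by blast
    fix y assume y: "y \<in> topspace T \<and> C = T closure_of {y}"
    have in_cl: "y \<in> T closure_of {r x}" "r x \<in> T closure_of {y}"
      using y rx gen closure_of_subset[of "{y}" T] closure_of_subset[of "{r x}" T] by auto
    have S: "s y \<in> topspace S" "s (r x) \<in> topspace S"
      using s y rx unfolding continuous_map_def by auto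
    have "S closure_of {s y} = S closure_of {s (r x)}"
      using le[of y "r x"] le[of "r x" y] in_cl y rx
      by (intro equalityI closure_of_minimal) auto
    then have "s y = s (r x)"
      using sober irreducible_closedin_closure_of_singleton[OF S(1)] S
      unfolding sober_space_def by metis
    then show "y = r x" using rs y rx by metis
  qed
qed

text \<open>Compact sets of the retract are moved to the larger space, saturated and intersected there,
  and brought back by the retraction, which maps the saturation of \<open>s ` K\<close> into \<open>K\<close>.\<close>

lemma stably_compact_space_retraction:
  assumes ret: "retraction_maps S T r s" and S: "stably_compact_space S"
  shows "stably_compact_space T"
proof -
  have r: "continuous_map S T r" and s: "continuous_map T S s"
    and rs: "\<And>y. y \<in> topspace T \<Longrightarrow> r (s y) = y"
    using ret unfolding retraction_maps_def by auto
  have r_surj: "r ` topspace S = topspace T"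
  proof
    show "r ` topspace S \<subseteq> topspace T" using continuous_map_image_subset_topspace[OF r] .
    have "s y \<in> topspace S" if "y \<in> topspace T" for y
      using s that unfolding continuous_map_def by blast
    then show "topspace T \<subseteq> r ` topspace S"
      using rs by (metis image_eqI subsetI)
  qed
  have "sober_space T"
    using S sober_space_retraction[OF ret] unfolding stably_compact_space_def by blast
  moreover have "neighbourhood_base_of (compactin T) T"
    unfolding neighbourhood_base_of
  proof (intro allI impI)
    fix W y assume W: "openin T W \<and> y \<in> W"
    then have y: "y \<in> topspace T" using openin_subset by blast
    have "s y \<in> topspace S" using s y unfolding continuous_map_def by blast
    then have "openin S {z \<in> topspace S. r z \<in> W}" "s y \<in> {z \<in> topspace S. r z \<in> W}"
      using W y rs openin_continuous_map_preimage[OF r] by auto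
    moreover have "neighbourhood_base_of (compactin S) S"
      using S unfolding stably_compact_space_def by blast
    ultimately obtain U K where UK: "openin S U" "compactin S K" "s y \<in> U" "U \<subseteq> K"
        "K \<subseteq> {z \<in> topspace S. r z \<in> W}"
      unfolding neighbourhood_base_of by (smt (verit, best))
    \<comment> \<open>The image of \<open>K\<close> under \<open>r\<close> is a neighbourhood of y
      because every z with \<open>s z \<in> U\<close> equals \<open>r (s z)\<close>.\<close>
    have "openin T {z \<in> topspace T. s z \<in> U}" "compactin T (r ` K)"
      using UK openin_continuous_map_preimage[OF s] image_compactin[OF _ r] by blast+
    moreover have "{z \<in> topspace T. s z \<in> U} \<subseteq> r ` K" using UK rs by (force simp: image_iff)
    ultimately show "\<exists>U V. openin T U \<and> compactin T V \<and> y \<in> U \<and> U \<subseteq> V \<and> V \<subseteq> W"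
      using UK y by (intro exI[of _ "{z \<in> topspace T. s z \<in> U}"] exI[of _ "r ` K"]) auto
  qed
  moreover have "compact_space T"
    using S image_compactin[OF _ r, of "topspace S"] r_surj
    unfolding stably_compact_space_def compact_space_def by simp
  moreover have "compactin T (K \<inter> L)"
    if K: "compactin T K" "saturatedin T K" and L: "compactin T L" "saturatedin T L" for K L
  proof -
    define sat where "sat M = \<Inter>{U. openin S U \<and> s ` M \<subseteq> U}" for M
    have sat: "compactin S (sat M)" "saturatedin S (sat M)" "s ` M \<subseteq> sat M" "r ` sat M \<subseteq> M"
      if M: "compactin T M" "saturatedin T M" for M
    proof -
      have sM: "s ` M \<subseteq> topspace S" "compactin S (s ` M)"
        using M compactin_subset_topspace image_compactin[OF _ s] by blast+
      have ub: "sat M \<subseteq> U" if "openin S U" "s ` M \<subseteq> U" for U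
        using that unfolding sat_def by blast
      show sub: "s ` M \<subseteq> sat M" unfolding sat_def by blast
      have top: "sat M \<subseteq> topspace S" using ub sM by blast
      \<comment> \<open>A finite subfamily that covers the image of \<open>M\<close> has an open
        union, and every open superset of that image contains \<open>sat M\<close>.\<close>
      show "compactin S (sat M)"
        unfolding compactin_def
      proof (intro conjI allI impI top)
        fix \<U> assume \<U>: "(\<forall>U\<in>\<U>. openin S U) \<and> sat M \<subseteq> \<Union>\<U>"
        then obtain \<F> where \<F>: "finite \<F>" "\<F> \<subseteq> \<U>" "s ` M \<subseteq> \<Union>\<F>"
          using sM(2) sub unfolding compactin_def by (meson subset_trans)
        have "openin S (\<Union>\<F>)" using \<F> \<U> by (intro openin_Union) blast
        then have "sat M \<subseteq> \<Union>\<F>" using \<F>(3) by (rule ub)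
        then show "\<exists>\<F>. finite \<F> \<and> \<F> \<subseteq> \<U> \<and> sat M \<subseteq> \<Union>\<F>" using \<F> by blast
      qed
      show "saturatedin S (sat M)"
        unfolding saturatedin_def
      proof (intro conjI top equalityI Inter_greatest)
        show "\<Inter>{U. openin S U \<and> sat M \<subseteq> U} \<subseteq> sat M"
          unfolding sat_def[of M] using ub by (intro Inter_anti_mono Collect_mono) blast
      qed blast
      \<comment> \<open>The preimage of \<open>V\<close> under \<open>r\<close> is an open superset
        of the image of \<open>M\<close>, hence contains \<open>sat M\<close>. As \<open>M\<close>
        is saturated, letting \<open>V\<close> vary brings the image down to
        \<open>M\<close>.\<close>
      have "r ` sat M \<subseteq> V" if V: "openin T V" "M \<subseteq> V" for V
      proof -
        have "s ` M \<subseteq> {z \<in> topspace S. r z \<in> V}"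
          using sM(1) V(2) rs openin_subset[OF V(1)] by (auto simp: image_subset_iff subset_iff)
        then have "sat M \<subseteq> {z \<in> topspace S. r z \<in> V}"
          by (rule ub[OF openin_continuous_map_preimage[OF r V(1)]])
        then show ?thesis by blast
      qed
      then have "r ` sat M \<subseteq> \<Inter>{V. openin T V \<and> M \<subseteq> V}" by blast
      also have "\<dots> = M" using M(2) unfolding saturatedin_def by simp
      finally show "r ` sat M \<subseteq> M" .
    qed
    have "K \<inter> L = r ` (sat K \<inter> sat L)"
    proof
      show "r ` (sat K \<inter> sat L) \<subseteq> K \<inter> L" using sat(4)[OF K] sat(4)[OF L] by blast
      show "K \<inter> L \<subseteq> r ` (sat K \<inter> sat L)"
      proof
        fix y assume y: "y \<in> K \<inter> L"
        then have "y \<in> topspace T" using K compactin_subset_topspace by blast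
        moreover have "s y \<in> sat K \<inter> sat L" using y sat(3)[OF K] sat(3)[OF L] by blast
        ultimately show "y \<in> r ` (sat K \<inter> sat L)" using rs by (metis imageI)
      qed
    qed
    moreover have "compactin S (sat K \<inter> sat L)"
      using S sat(1,2)[OF K] sat(1,2)[OF L] unfolding stably_compact_space_def by blast
    ultimately show ?thesis using image_compactin[OF _ r] by simp
  qed
  ultimately show ?thesis unfolding stably_compact_space_def by blast
qed

section \<open>The topology of pointwise convergence\<close>

text \<open>Admits infinite thresholds, for which the set is empty. Values of maps and sums such as
  \<open>q + ennreal (\<alpha> * s)\<close> can then serve as thresholds.\<close>

lemma openin_pointwise_less:
  assumes "x \<in> X"
  shows "openin (pointwise_topology X F) {f \<in> F. q < f x}"
proof (cases q)
  case (real r)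
  then have "{f \<in> F. q < f x} \<in> {{f\<in>F. ennreal r < f x} | x r. x \<in> X \<and> 0 \<le> r}"
    using assms by blast
  then show ?thesis
    unfolding pointwise_topology_def by (intro topology_generated_by_Basis) blast
next
  case top
  then show ?thesis by simp
qed

lemma continuous_map_into_pointwise:
  assumes "f \<in> topspace T \<rightarrow> F"
    and "\<And>x q. x \<in> X \<Longrightarrow> openin T {t \<in> topspace T. q < f t x}"
  shows "continuous_map T (pointwise_topology X F) f"
  unfolding pointwise_topology_def
proof (rule continuous_on_generated_topo)
  fix U assume "U \<in> insert F {{f\<in>F. ennreal r < f x} | x r. x \<in> X \<and> 0 \<le> r}"
  then consider "U = F" | x r where "x \<in> X" "U = {f \<in> F. ennreal r < f x}" by blast
  then show "openin T (f -` U \<inter> topspace T)"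
  proof cases
    case 1
    then have "f -` U \<inter> topspace T = topspace T" using assms(1) by blast
    then show ?thesis by simp
  next
    case 2
    then have "f -` U \<inter> topspace T = {t \<in> topspace T. ennreal r < f t x}" using assms(1) by blast
    then show ?thesis using assms(2) 2 by simp
  qed
qed (use assms(1) in blast)

lemma openin_pointwise_upward:
  assumes "openin (pointwise_topology X F) U" "f \<in> U" "g \<in> F" "pointwise_le X f g"
  shows "g \<in> U"
proof -
  have "generate_topology_on (insert F {{f\<in>F. ennreal r < f x} | x r. x \<in> X \<and> 0 \<le> r}) U"
    using assms(1) unfolding pointwise_topology_def by (rule openin_topology_generated_by)
  then show ?thesis using assms(2)
  proof induction
    case (Basis s)
    then consider "s = F" | x r where "x \<in> X" "s = {f \<in> F. ennreal r < f x}" by blast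
    then show ?case
    proof cases
      case 1
      then show ?thesis using assms(3) by simp
    next
      case 2
      then have "ennreal r < f x" using Basis(2) by simp
      also have "f x \<le> g x" using assms(4) 2 unfolding pointwise_le_def by simp
      finally show ?thesis using assms(3) 2 by simp
    qed
  qed auto
qed

section \<open>Closed subsets of powers of the extended half-line\<close>

abbreviation ennreal_cube :: "'a set \<Rightarrow> ('a \<Rightarrow> ennreal) topology" where
  "ennreal_cube X \<equiv> product_topology (\<lambda>_. euclidean) X"

lemma compact_space_ennreal_cube: "compact_space (ennreal_cube X)"
proof -
  have "compact (UNIV :: ennreal set)"
    by (rule compact_UNIV)
  then show ?thesis
    by (simp add: compact_space_product_topology) (simp add: compact_space_def)
qed

lemma openin_ennreal_cube_vimage:
  assumes "x \<in> X" "open S"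
  shows "openin (ennreal_cube X) {f \<in> topspace (ennreal_cube X). f x \<in> S}"
  using openin_continuous_map_preimage[OF continuous_map_product_projection[OF assms(1), of "\<lambda>_. euclidean"], of S]
    assms(2) by simp

lemma closedin_ennreal_cube_vimage:
  assumes "x \<in> X" "closed S"
  shows "closedin (ennreal_cube X) {f \<in> topspace (ennreal_cube X). f x \<in> S}"
  using closedin_continuous_map_preimage[OF continuous_map_product_projection[OF assms(1), of "\<lambda>_. euclidean"], of S]
    assms(2) by simp

context
  fixes X :: "'a set" and F :: "('a \<Rightarrow> ennreal) set"
  assumes F: "closedin (ennreal_cube X) F"
begin

lemma closedin_ennreal_cube_subset: "F \<subseteq> topspace (ennreal_cube X)"
  using F closedin_subset by blast

text \<open>The pointwise topology only has the lower half of the open conditions of the cube.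
  Compactness therefore passes from the cube to it, and closedness back to the cube.\<close>

lemma continuous_map_cube_pointwise:
  "continuous_map (subtopology (ennreal_cube X) F) (pointwise_topology X F) (\<lambda>f. f)"
proof (rule continuous_map_into_pointwise)
  have top: "topspace (subtopology (ennreal_cube X) F) = F"
    using closedin_ennreal_cube_subset by (rule topspace_subtopology_subset)
  then show "(\<lambda>f. f) \<in> topspace (subtopology (ennreal_cube X) F) \<rightarrow> F" by simp
  fix x q assume "x \<in> X"
  then have "openin (ennreal_cube X) {f \<in> topspace (ennreal_cube X). f x \<in> {q<..}}"
    by (rule openin_ennreal_cube_vimage) simp
  moreover have "{f \<in> F. q < f x} = {f \<in> topspace (ennreal_cube X). f x \<in> {q<..}} \<inter> F"
    using closedin_ennreal_cube_subset by auto
  ultimately show "openin (subtopology (ennreal_cube X) F)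
      {t \<in> topspace (subtopology (ennreal_cube X) F). q < t x}"
    unfolding top openin_subtopology by blast
qed

lemma compactin_pointwise_if_closedin_cube:
  assumes "closedin (ennreal_cube X) K" "K \<subseteq> F"
  shows "compactin (pointwise_topology X F) K"
proof -
  have "compactin (subtopology (ennreal_cube X) F) K"
    using assms closedin_compact_space[OF compact_space_ennreal_cube]
    by (simp add: compactin_subtopology)
  then show ?thesis
    using image_compactin[OF _ continuous_map_cube_pointwise] by fastforce
qed

lemma closedin_cube_if_closedin_pointwise:
  assumes "closedin (pointwise_topology X F) C"
  shows "closedin (ennreal_cube X) C"
proof -
  have "{f \<in> F. f \<in> C} = C" using closedin_subset[OF assms] by auto
  moreover have "topspace (subtopology (ennreal_cube X) F) = F"
    using closedin_ennreal_cube_subset by (rule topspace_subtopology_subset)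
  ultimately have "closedin (subtopology (ennreal_cube X) F) C"
    using closedin_continuous_map_preimage[OF continuous_map_cube_pointwise assms] by (simp only:)
  then show ?thesis using closedin_trans_full[OF _ F] by blast
qed

text \<open>If \<open>g\<close> is outside \<open>K\<close>, every k in \<open>K\<close> exceeds
  \<open>g\<close> at some coordinate, since otherwise \<open>g\<close>, being above k, would lie in
  \<open>K\<close>. Thresholds between the two values give an open cover of \<open>K\<close>; a
  finite subcover bounds \<open>g\<close> from above at finitely many coordinates, and these bounds
  define an open set of the cube that misses \<open>K\<close>.\<close>

lemma closedin_cube_if_compact_saturated:
  assumes K: "compactin (pointwise_topology X F) K" and sat: "saturatedin (pointwise_topology X F) K"
  shows "closedin (ennreal_cube X) K"
proof -
  have KF: "K \<subseteq> F" using compactin_subset_topspace[OF K] by simp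
  have up: "g \<in> K" if "k \<in> K" "g \<in> F" "pointwise_le X k g" for k g
  proof -
    have "g \<in> \<Inter>{U. openin (pointwise_topology X F) U \<and> K \<subseteq> U}"
      using that openin_pointwise_upward by blast
    also have "\<dots> = K" using sat unfolding saturatedin_def by simp
    finally show ?thesis .
  qed
  have "\<exists>V. openin (ennreal_cube X) V \<and> g \<in> V \<and> V \<inter> K = {}"
    if g: "g \<in> F" "g \<notin> K" for g
  proof -
    define I where "I = {(x, q). x \<in> X \<and> g x < q}"
    define U where "U = (\<lambda>(x, q). {f \<in> F. q < f x})"
    have "K \<subseteq> \<Union>(U ` I)"
    proof
      fix k assume k: "k \<in> K"
      then obtain x where x: "x \<in> X" "g x < k x"
        using up g unfolding pointwise_le_def by (meson not_le)
      then obtain q where "g x < q" "q < k x" using dense by blast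
      then show "k \<in> \<Union>(U ` I)"
        using x k KF unfolding I_def U_def by blast
    qed
    moreover have "\<forall>V\<in>U ` I. openin (pointwise_topology X F) V"
      unfolding U_def I_def by (auto intro: openin_pointwise_less)
    ultimately obtain \<F> where "finite \<F>" "\<F> \<subseteq> U ` I" "K \<subseteq> \<Union>\<F>"
      using K unfolding compactin_def by meson
    then obtain J where J: "finite J" "J \<subseteq> I" "K \<subseteq> \<Union>(U ` J)"
      using finite_subset_image by metis
    \<comment> \<open>The topspace is included for the case of empty \<open>J\<close>, where the
      intersection over \<open>J\<close> is \<open>UNIV\<close>.\<close>
    define V where "V = topspace (ennreal_cube X) \<inter>
      (\<Inter>(x, q)\<in>J. {f \<in> topspace (ennreal_cube X). f x \<in> {..<q}})"
    have "openin (ennreal_cube X) W"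
      if "W \<in> (\<lambda>(x, q). {f \<in> topspace (ennreal_cube X). f x \<in> {..<q}}) ` J" for W
      using that J(2) unfolding I_def by (auto intro!: openin_ennreal_cube_vimage[OF _ open_lessThan]
          simp del: lessThan_iff topspace_product_topology)
    then have "openin (ennreal_cube X) V"
      unfolding V_def using J(1) by (intro openin_Int_Inter) (auto simp del: topspace_product_topology)
    moreover have "g \<in> V" using g closedin_ennreal_cube_subset J(2) unfolding V_def I_def by auto
    moreover have "V \<inter> K = {}"
      using J(3) unfolding V_def U_def by (fastforce dest: order.asym)
    ultimately show ?thesis by blast
  qed
  moreover have "\<exists>V. openin (ennreal_cube X) V \<and> g \<in> V \<and> V \<inter> K = {}"
    if "g \<in> topspace (ennreal_cube X)" "g \<notin> F" for g
    using that F KF unfolding closedin_def by (intro exI[of _ "topspace (ennreal_cube X) - F"]) auto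
  ultimately have nb: "\<exists>V. openin (ennreal_cube X) V \<and> g \<in> V \<and> V \<inter> K = {}"
    if "g \<in> topspace (ennreal_cube X) - K" for g
    using that by (cases "g \<in> F") auto
  have "openin (ennreal_cube X) (topspace (ennreal_cube X) - K)"
  proof (subst openin_subopen, intro ballI)
    fix g assume "g \<in> topspace (ennreal_cube X) - K"
    then obtain V where V: "openin (ennreal_cube X) V" "g \<in> V" "V \<inter> K = {}" using nb by blast
    moreover have "V \<subseteq> topspace (ennreal_cube X) - K" using V openin_subset by blast
    ultimately show "\<exists>T. openin (ennreal_cube X) T \<and> g \<in> T \<and> T \<subseteq> topspace (ennreal_cube X) - K"
      by blast
  qed
  then show ?thesis using KF closedin_ennreal_cube_subset unfolding closedin_def by blast
qed

text \<open>For a subbasic set and r < q < f x, the condition "at least q" is closed in the cube and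
  lies between "above q" and "above r". Closed rather than merely compact sets are asked for so that
  the induction survives binary intersections.\<close>

lemma neighbourhood_base_pointwise:
  assumes "openin (pointwise_topology X F) W" "f \<in> W"
  shows "\<exists>U V. openin (pointwise_topology X F) U \<and> closedin (ennreal_cube X) V \<and>
    f \<in> U \<and> U \<subseteq> V \<and> V \<subseteq> W"
proof -
  have "generate_topology_on (insert F {{f\<in>F. ennreal r < f x} | x r. x \<in> X \<and> 0 \<le> r}) W"
    using assms(1) unfolding pointwise_topology_def by (rule openin_topology_generated_by)
  then show ?thesis using assms(2)
  proof induction
    case (Int A B)
    then obtain U V U' V' where
      "openin (pointwise_topology X F) U" "closedin (ennreal_cube X) V" "f \<in> U" "U \<subseteq> V" "V \<subseteq> A"
      "openin (pointwise_topology X F) U'" "closedin (ennreal_cube X) V'" "f \<in> U'" "U' \<subseteq> V'" "V' \<subseteq> B"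
      by auto
    then show ?case by (intro exI[of _ "U \<inter> U'"] exI[of _ "V \<inter> V'"]) auto
  next
    case (UN \<K>)
    then obtain W where W: "W \<in> \<K>" "f \<in> W" by blast
    then obtain U V where "openin (pointwise_topology X F) U" "closedin (ennreal_cube X) V"
        "f \<in> U" "U \<subseteq> V" "V \<subseteq> W"
      using UN.IH[OF W] by blast
    moreover have "V \<subseteq> \<Union>\<K>" using \<open>V \<subseteq> W\<close> W(1) by (rule order_trans[OF _ Union_upper])
    ultimately show ?case by (intro exI conjI)
  next
    case (Basis W)
    then consider "W = F" | x r where "x \<in> X" "W = {f \<in> F. ennreal r < f x}" by blast
    then show ?case
    proof cases
      case 1
      have "openin (pointwise_topology X F) F"
        using openin_topspace[of "pointwise_topology X F"] by simp
      then show ?thesis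
        using 1 F Basis(2) by (intro exI[of _ F] conjI) auto
    next
      case 2
      then have "ennreal r < f x" "f \<in> F" using Basis(2) by auto
      then obtain q where q: "ennreal r < q" "q < f x" "f \<in> F"
        using dense[of "ennreal r" "f x"] by blast
      have "closedin (ennreal_cube X) ({f \<in> topspace (ennreal_cube X). f x \<in> {q..}} \<inter> F)"
        using 2 F by (intro closedin_Int closedin_ennreal_cube_vimage) auto
      moreover have "openin (pointwise_topology X F) {f \<in> F. q < f x}"
        using 2 by (intro openin_pointwise_less)
      ultimately show ?thesis
        using q 2 closedin_ennreal_cube_subset
        by (intro exI[of _ "{f \<in> F. q < f x}"] conjI
            exI[of _ "{f \<in> topspace (ennreal_cube X). f x \<in> {q..}} \<inter> F"])
          (auto intro: less_imp_le elim: less_le_trans)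
    qed
  qed simp
qed

text \<open>The specialization preorder is the pointwise order: open sets are upward closed, and the
  threshold \<open>m x\<close> separates \<open>f\<close> from \<open>m\<close> when
  \<open>f x\<close> is larger.\<close>

lemma closure_of_pointwise_singleton:
  assumes "m \<in> F"
  shows "pointwise_topology X F closure_of {m} = {f \<in> F. pointwise_le X f m}"
proof (intro equalityI subsetI)
  fix f assume f: "f \<in> pointwise_topology X F closure_of {m}"
  then have fF: "f \<in> F"
    and mU: "\<And>U. f \<in> U \<Longrightarrow> openin (pointwise_topology X F) U \<Longrightarrow> m \<in> U"
    by (auto simp: in_closure_of)
  have "f x \<le> m x" if "x \<in> X" for x
  proof (rule ccontr)
    assume "\<not> f x \<le> m x"
    then have "f \<in> {f \<in> F. m x < f x}" using fF by simp
    moreover have "openin (pointwise_topology X F) {f \<in> F. m x < f x}"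
      using that by (rule openin_pointwise_less)
    ultimately have "m \<in> {f \<in> F. m x < f x}"
      by (rule mU)
    then show False by simp
  qed
  then show "f \<in> {f \<in> F. pointwise_le X f m}" using fF unfolding pointwise_le_def by blast
next
  fix f assume "f \<in> {f \<in> F. pointwise_le X f m}"
  then show "f \<in> pointwise_topology X F closure_of {m}"
    using openin_pointwise_upward[of X F _ f m] assms unfolding in_closure_of by auto
qed

text \<open>The generic point of an irreducible closed set is its pointwise supremum, which is attained
  by compactness of the cube.\<close>

lemma sober_space_pointwise: "sober_space (pointwise_topology X F)"
  unfolding sober_space_def
proof (intro allI impI)
  fix C assume C: "irreducible_closedin (pointwise_topology X F) C"
  then have cl: "closedin (pointwise_topology X F) C"
    unfolding irreducible_closedin_def by blast
  have CF: "C \<subseteq> F" using closedin_subset[OF cl] by simp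
  define m where "m = (\<lambda>x. SUP g\<in>C. g x)"
  have "\<exists>h\<in>C. \<forall>x\<in>X. m x \<le> h x"
  proof (rule ccontr)
    assume no: "\<not> (\<exists>h\<in>C. \<forall>x\<in>X. m x \<le> h x)"
    define I where "I = {(x, q). x \<in> X \<and> q < m x}"
    define U where "U = (\<lambda>(x, q). {f \<in> topspace (ennreal_cube X). f x \<in> {..<q}})"
    define V where "V = (\<lambda>(x, q). {f \<in> F. q < f x})"
    \<comment> \<open>If no member of \<open>C\<close> reaches the supremum \<open>m\<close>
      everywhere, each one stays below some threshold q < m x. Compactness reduces these thresholds
      to finitely many.\<close>
    have "C \<subseteq> \<Union>(U ` I)"
    proof
      fix h assume h: "h \<in> C"
      then obtain x where x: "x \<in> X" "h x < m x" using no by (meson not_le)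
      then obtain q where "h x < q" "q < m x" using dense by blast
      then show "h \<in> \<Union>(U ` I)" using x h CF closedin_ennreal_cube_subset unfolding U_def I_def by blast
    qed
    moreover have "compactin (ennreal_cube X) C"
      using closedin_cube_if_closedin_pointwise[OF cl] compact_space_ennreal_cube
      by (rule closedin_compact_space[rotated])
    moreover have "\<forall>W\<in>U ` I. openin (ennreal_cube X) W"
      unfolding U_def I_def
      by (auto intro!: openin_ennreal_cube_vimage[OF _ open_lessThan]
          simp del: lessThan_iff topspace_product_topology)
    ultimately obtain \<F> where "finite \<F>" "\<F> \<subseteq> U ` I" "C \<subseteq> \<Union>\<F>"
      unfolding compactin_def by meson
    then obtain J where J: "finite J" "J \<subseteq> I" "C \<subseteq> \<Union>(U ` J)"
      using finite_subset_image by metis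
    \<comment> \<open>Each single threshold is exceeded by a member of \<open>C\<close>, as it is
      below the supremum. Irreducibility gives one member that exceeds all the thresholds of
      \<open>J\<close> together, against the finite cover.\<close>
    have "openin (pointwise_topology X F) W \<and> W \<inter> C \<noteq> {}" if WJ: "W \<in> V ` J" for W
    proof -
      obtain x q where W: "W = {f \<in> F. q < f x}" "x \<in> X" "q < m x"
        using WJ J(2) unfolding V_def I_def by auto
      then obtain g where "g \<in> C" "q < g x" unfolding m_def less_SUP_iff by blast
      then have "g \<in> W \<inter> C" using W(1) CF by blast
      moreover have "openin (pointwise_topology X F) W"
        unfolding W(1) using W(2) by (rule openin_pointwise_less)
      ultimately show ?thesis by blast
    qed
    then obtain W where "W \<inter> C \<noteq> {}" "W \<subseteq> \<Inter>(V ` J)"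
      using irreducible_closedin_meets_finite_Inter[OF C, of "V ` J"] J(1) by blast
    then obtain h where h: "h \<in> C" "h \<in> \<Inter>(V ` J)" by blast
    then obtain i where "i \<in> J" "h \<in> U i" using J(3) by blast
    moreover have "h \<in> V i" using h \<open>i \<in> J\<close> by blast
    ultimately show False unfolding U_def V_def by (auto split: prod.splits)
  qed
  then obtain h where h: "h \<in> C" "\<And>x. x \<in> X \<Longrightarrow> m x \<le> h x" by blast
  have ub: "pointwise_le X g h" if "g \<in> C" for g
    unfolding pointwise_le_def
  proof
    fix x assume "x \<in> X"
    have "g x \<le> m x" unfolding m_def using that by (rule SUP_upper)
    also have "\<dots> \<le> h x" using \<open>x \<in> X\<close> by (rule h(2))
    finally show "g x \<le> h x" .
  qed
  have hF: "h \<in> F" using h CF by blast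
  have eq: "C = pointwise_topology X F closure_of {h}"
  proof
    show "C \<subseteq> pointwise_topology X F closure_of {h}"
      unfolding closure_of_pointwise_singleton[OF hF] using ub CF by blast
    show "pointwise_topology X F closure_of {h} \<subseteq> C"
      using h cl by (intro closure_of_minimal) auto
  qed
  show "\<exists>!x. x \<in> topspace (pointwise_topology X F) \<and> C = pointwise_topology X F closure_of {x}"
  proof (rule ex1I[of _ h])
    show "h \<in> topspace (pointwise_topology X F) \<and> C = pointwise_topology X F closure_of {h}"
      using hF eq by simp
    fix k assume "k \<in> topspace (pointwise_topology X F) \<and> C = pointwise_topology X F closure_of {k}"
    then have k: "k \<in> F" "C = {f \<in> F. pointwise_le X f k}"
      using closure_of_pointwise_singleton by auto
    then have "k \<in> C" unfolding pointwise_le_def by blast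
    then have "pointwise_le X k h" by (rule ub)
    moreover have "pointwise_le X h k" using h(1) k(2) by blast
    ultimately have "k x = h x" if "x \<in> X" for x
      using that unfolding pointwise_le_def by (simp add: order_antisym)
    moreover have "k \<in> extensional X" "h \<in> extensional X"
      using k hF closedin_ennreal_cube_subset by (auto simp: PiE_def)
    ultimately show "k = h" by (intro extensionalityI)
  qed
qed

lemma stably_compact_space_pointwise: "stably_compact_space (pointwise_topology X F)"
  unfolding stably_compact_space_def
proof (intro conjI allI impI)
  show "sober_space (pointwise_topology X F)" by (rule sober_space_pointwise)
  show "compact_space (pointwise_topology X F)"
    using compactin_pointwise_if_closedin_cube[OF F] unfolding compact_space_def by simp
  show "neighbourhood_base_of (compactin (pointwise_topology X F)) (pointwise_topology X F)"
    unfolding neighbourhood_base_of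
  proof (intro allI impI)
    fix W f assume W: "openin (pointwise_topology X F) W \<and> f \<in> W"
    then obtain U V where "openin (pointwise_topology X F) U" "closedin (ennreal_cube X) V"
        "f \<in> U" "U \<subseteq> V" "V \<subseteq> W"
      using neighbourhood_base_pointwise[of W f] by auto
    moreover have "W \<subseteq> F" using W openin_subset[of "pointwise_topology X F" W] by simp
    ultimately show "\<exists>U V. openin (pointwise_topology X F) U \<and>
        compactin (pointwise_topology X F) V \<and> f \<in> U \<and> U \<subseteq> V \<and> V \<subseteq> W"
      using compactin_pointwise_if_closedin_cube[OF _ order_trans] by (intro exI conjI)
  qed
  fix K L
  assume "compactin (pointwise_topology X F) K \<and> saturatedin (pointwise_topology X F) K \<and>
    compactin (pointwise_topology X F) L \<and> saturatedin (pointwise_topology X F) L"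
  then show "compactin (pointwise_topology X F) (K \<inter> L)"
    using closedin_cube_if_compact_saturated compactin_subset_topspace[of "pointwise_topology X F" K]
    by (intro compactin_pointwise_if_closedin_cube closedin_Int) auto
qed

end

section \<open>Continuous posets\<close>

lemma way_below_imp_le:
  assumes "poset_on P le" "y \<in> P" "way_below P le x y"
  shows "le x y"
proof -
  have "directed_in P le {y}" "is_sup_in P le {y} y" "le y y"
    using assms(1,2) unfolding directed_in_def is_sup_in_def poset_on_def reflp_on_def by blast+
  then show ?thesis using assms(3) unfolding way_below_def by blast
qed

lemma way_below_le_trans:
  assumes "poset_on P le" "way_below P le x y" "le y z" "y \<in> P" "z \<in> P"
  shows "way_below P le x z"
  unfolding way_below_def
proof (intro allI impI)
  fix D u assume D: "directed_in P le D \<and> is_sup_in P le D u \<and> le z u"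
  then have "le y u"
    using assms(1,3-5) unfolding poset_on_def is_sup_in_def by (meson transp_onD)
  then show "\<exists>z\<in>D. le x z" using assms(2) D unfolding way_below_def by blast
qed

lemma le_way_below_trans:
  assumes "poset_on P le" "le x y" "way_below P le y z" "x \<in> P" "y \<in> P"
  shows "way_below P le x z"
  unfolding way_below_def
proof (intro allI impI)
  fix D u assume D: "directed_in P le D \<and> is_sup_in P le D u \<and> le z u"
  then obtain w where "w \<in> D" "le y w" using assms(3) unfolding way_below_def by blast
  moreover have "w \<in> P" using D \<open>w \<in> D\<close> unfolding directed_in_def by blast
  ultimately have "le x w"
    using assms(1,2,4,5) unfolding poset_on_def by (meson transp_onD)
  then show "\<exists>w\<in>D. le x w" using \<open>w \<in> D\<close> by blast
qed

text \<open>The elements way below something way below z form a directed set whose supremum is still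
  z, so x lies below one of them.\<close>

lemma way_below_interpolate:
  assumes P: "continuous_poset_on P le" and x: "x \<in> P" and z: "z \<in> P" and wb: "way_below P le x z"
  shows "\<exists>y\<in>P. way_below P le x y \<and> way_below P le y z"
proof -
  have po: "poset_on P le" using P unfolding continuous_poset_on_def by blast
  have dir: "directed_in P le {y \<in> P. way_below P le y v}"
    and sup: "is_sup_in P le {y \<in> P. way_below P le y v} v" if "v \<in> P" for v
    using P that unfolding continuous_poset_on_def by blast+
  define D where "D = {w \<in> P. \<exists>v\<in>P. way_below P le w v \<and> way_below P le v z}"
  have "directed_in P le D"
    unfolding directed_in_def
  proof (intro conjI ballI)
    show "D \<subseteq> P" unfolding D_def by blast
    obtain v where v: "v \<in> P" "way_below P le v z"
      using dir[OF z] unfolding directed_in_def by blast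
    then obtain w where "w \<in> P" "way_below P le w v"
      using dir[OF v(1)] unfolding directed_in_def by blast
    with v show "D \<noteq> {}" unfolding D_def by blast
    fix w1 w2 assume "w1 \<in> D" "w2 \<in> D"
    then obtain v1 v2 where w: "w1 \<in> P" "w2 \<in> P" "v1 \<in> P" "v2 \<in> P" "way_below P le w1 v1"
        "way_below P le w2 v2" "way_below P le v1 z" "way_below P le v2 z"
      unfolding D_def by blast
    then obtain v where v: "v \<in> P" "way_below P le v z" "le v1 v" "le v2 v"
      using dir[OF z] unfolding directed_in_def by blast
    then have "way_below P le w1 v" "way_below P le w2 v"
      using w way_below_le_trans[OF po] by blast+
    then obtain w where "w \<in> P" "way_below P le w v" "le w1 w" "le w2 w"
      using w dir[OF v(1)] unfolding directed_in_def by blast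
    then show "\<exists>w\<in>D. le w1 w \<and> le w2 w" using v unfolding D_def by blast
  qed
  moreover have "is_sup_in P le D z"
    unfolding is_sup_in_def
  proof (intro conjI ballI impI z)
    fix w assume "w \<in> D"
    then obtain v where "w \<in> P" "v \<in> P" "way_below P le w v" "way_below P le v z"
      unfolding D_def by blast
    then show "le w z" by (meson po way_below_imp_le way_below_le_trans z)
  next
    fix u assume u: "u \<in> P" "\<forall>w\<in>D. le w u"
    \<comment> \<open>Everything way below v belongs to \<open>D\<close>, so u bounds it, and v is
      the supremum of what is way below it.\<close>
    have "le v u" if v: "v \<in> P" "way_below P le v z" for v
      using sup[OF v(1)] u v unfolding is_sup_in_def D_def by blast
    then show "le z u" using sup[OF z] u(1) unfolding is_sup_in_def by blast
  qed
  moreover have "le z z" using po z unfolding poset_on_def reflp_on_def by blast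
  ultimately obtain w where "w \<in> D" "le x w" using wb unfolding way_below_def by blast
  then show ?thesis using le_way_below_trans[OF po] x unfolding D_def by blast
qed

text \<open>If x is way below the supremum u of \<open>D\<close>, an interpolated y between them
  lies below some member of \<open>D\<close>, which is then way above x.\<close>

lemma scott_open_way_above:
  assumes P: "continuous_poset_on P le" and x: "x \<in> P"
  shows "scott_open P le {y \<in> P. way_below P le x y}"
  unfolding scott_open_def
proof (intro conjI ballI allI impI)
  have po: "poset_on P le" using P unfolding continuous_poset_on_def by blast
  fix y z assume "y \<in> {y \<in> P. way_below P le x y}" "z \<in> P" "le y z"
  then show "z \<in> {y \<in> P. way_below P le x y}" using way_below_le_trans[OF po] by blast
next
  have po: "poset_on P le" using P unfolding continuous_poset_on_def by blast
  fix D u assume D: "directed_in P le D \<and> is_sup_in P le D u \<and> u \<in> {y \<in> P. way_below P le x y}"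
  then obtain y where y: "y \<in> P" "way_below P le x y" "way_below P le y u"
    using way_below_interpolate[OF P x] by blast
  have "le u u" using po D unfolding poset_on_def reflp_on_def by blast
  then obtain z where "z \<in> D" "le y z" using y D unfolding way_below_def by blast
  moreover have "z \<in> P" using D \<open>z \<in> D\<close> unfolding directed_in_def by blast
  ultimately show "D \<inter> {y \<in> P. way_below P le x y} \<noteq> {}"
    using way_below_le_trans[OF po] y by blast
qed blast

lemma is_sup_in_unique:
  assumes "poset_on P le" "is_sup_in P le D u" "is_sup_in P le D v"
  shows "u = v"
  using assms unfolding poset_on_def is_sup_in_def by (meson antisymp_onD)

section \<open>Formal balls\<close>

text \<open>The shift in the definition of standardness, with negative \<open>s\<close> allowed so
  that it can be undone by the same function. Staying within the formal balls is then a separate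
  condition.\<close>

definition shift_ball :: "real \<Rightarrow> 'a \<times> real \<Rightarrow> 'a \<times> real" where
  "shift_ball s = (\<lambda>(x, r). (x, r + s))"

lemma shift_ball_simp [simp]: "shift_ball s (x, r) = (x, r + s)"
  by (simp add: shift_ball_def)

lemma ball_le_shift [simp]: "ball_le d (shift_ball s b) (shift_ball s c) = ball_le d b c"
  by (cases b; cases c) (simp add: ball_le_def)

lemma ball_le_shift_left: "ball_le d (shift_ball s b) (y, t) = ball_le d b (y, t - s)"
  by (cases b) (simp add: ball_le_def algebra_simps)

lemma ball_le_shift_right: "ball_le d (x, r) (shift_ball s c) = ball_le d (x, r - s) c"
  by (cases c) (simp add: ball_le_def algebra_simps)

lemma shift_ball_shift_ball [simp]: "shift_ball s (shift_ball t b) = shift_ball (t + s) b"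
  by (cases b) simp

lemma shift_ball_0 [simp]: "shift_ball 0 = id"
  by (auto simp: shift_ball_def)

lemma mem_formal_balls [simp]: "(x, r) \<in> formal_balls X \<longleftrightarrow> x \<in> X \<and> 0 \<le> r"
  by (auto simp: formal_balls_def)

lemma directed_in_shift_ball:
  assumes "directed_in (formal_balls X) (ball_le d) D" "shift_ball s ` D \<subseteq> formal_balls X"
  shows "directed_in (formal_balls X) (ball_le d) (shift_ball s ` D)"
  using assms unfolding directed_in_def by auto

locale continuous_quasi_metric =
  fixes X :: "'a set" and d :: "'a \<Rightarrow> 'a \<Rightarrow> ennreal"
  assumes quasi_metric: "quasi_metric_on X d" and continuous: "continuous_qms X d"
begin

abbreviation is_ball_sup :: "('a \<times> real) set \<Rightarrow> 'a \<times> real \<Rightarrow> bool" where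
  "is_ball_sup D u \<equiv>
    directed_in (formal_balls X) (ball_le d) D \<and> is_sup_in (formal_balls X) (ball_le d) D u"

abbreviation ball_way_below :: "'a \<times> real \<Rightarrow> 'a \<times> real \<Rightarrow> bool" (infix "\<lless>" 50) where
  "ball_way_below \<equiv> way_below (formal_balls X) (ball_le d)"

lemma poset: "poset_on (formal_balls X) (ball_le d)"
  using quasi_metric by (rule poset_on_formal_balls)

lemma continuous_poset: "continuous_poset_on (formal_balls X) (ball_le d)"
  using continuous unfolding continuous_qms_def by blast

text \<open>Standardness only yields some supremum (y, t) of the shifted family. As (x, r + s) is an
  upper bound, t is at least r + s, so (y, t - s) is a formal ball and bounds \<open>D\<close>.
  Comparison with (x, r) and antisymmetry identify the two.\<close>

lemma is_ball_sup_shift_nonneg: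
  assumes sup: "is_ball_sup D (x, r)" and s: "0 \<le> s"
  shows "is_ball_sup (shift_ball s ` D) (x, r + s)"
proof -
  have D: "D \<subseteq> formal_balls X" "D \<noteq> {}" using sup unfolding directed_in_def by blast+
  have xr: "(x, r) \<in> formal_balls X" using sup unfolding is_sup_in_def by blast
  have ub: "ball_le d b (x, r)" if "b \<in> D" for b using sup that unfolding is_sup_in_def by blast
  have "\<exists>u. is_sup_in (formal_balls X) (ball_le d) (shift_ball s ` D) u"
    using sup s continuous unfolding continuous_qms_def standard_qms_def shift_ball_def by blast
  then obtain y t where yt: "is_sup_in (formal_balls X) (ball_le d) (shift_ball s ` D) (y, t)"
    by auto
  then have y: "y \<in> X" "0 \<le> t" unfolding is_sup_in_def by auto
  have "ball_le d (shift_ball s b) (x, r + s)" if "b \<in> D" for b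
    using ub[OF that] by (simp add: ball_le_shift_left)
  then have le1: "ball_le d (y, t) (x, r + s)"
    using yt xr s unfolding is_sup_in_def by auto
  then have st: "r + s \<le> t" by (auto simp: ball_le_def)
  have "ball_le d b (y, t - s)" if "b \<in> D" for b
    using yt that unfolding is_sup_in_def by (simp add: ball_le_shift_left)
  moreover have "(y, t - s) \<in> formal_balls X" using y st xr by simp
  ultimately have "ball_le d (x, r) (y, t - s)" using sup unfolding is_sup_in_def by blast
  then have "ball_le d (x, r + s) (y, t)" by (simp add: ball_le_def algebra_simps)
  then have "(x, r + s) = (y, t)"
    using le1 poset y xr s unfolding poset_on_def by (intro antisymp_onD[of _ "ball_le d"]) auto
  moreover have "shift_ball s ` D \<subseteq> formal_balls X" using D s by auto
  then have "directed_in (formal_balls X) (ball_le d) (shift_ball s ` D)"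
    using sup directed_in_shift_ball by blast
  ultimately show ?thesis using yt by simp
qed

text \<open>For negative \<open>s\<close> the converse half of standardness gives a supremum of the
  shifted family; shifting it back up must return (x, r), which determines it.\<close>

lemma is_ball_sup_shift:
  assumes sup: "is_ball_sup D (x, r)" and sub: "shift_ball s ` D \<subseteq> formal_balls X"
  shows "is_ball_sup (shift_ball s ` D) (x, r + s)"
proof (cases "0 \<le> s")
  case True
  then show ?thesis using is_ball_sup_shift_nonneg[OF sup] by blast
next
  case False
  define E where "E = shift_ball s ` D"
  have dir: "directed_in (formal_balls X) (ball_le d) E"
    unfolding E_def using sup sub directed_in_shift_ball by blast
  have D: "D = shift_ball (- s) ` E" unfolding E_def by (simp add: image_image)
  then have "\<exists>u. is_sup_in (formal_balls X) (ball_le d) (shift_ball (- s) ` E) u"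
    using sup by blast
  then have "\<exists>u. is_sup_in (formal_balls X) (ball_le d) E u"
    using dir continuous False
    unfolding continuous_qms_def standard_qms_def shift_ball_def by (meson neg_0_le_iff_le nle_le)
  then obtain y t where yt: "is_ball_sup E (y, t)" using dir by auto
  then have "is_ball_sup D (y, t - s)"
    using is_ball_sup_shift_nonneg[OF yt, of "- s"] False unfolding D by simp
  then have "(x, r) = (y, t - s)" using sup is_sup_in_unique[OF poset] by blast
  then show ?thesis using yt unfolding E_def by simp
qed

text \<open>If all radii were at least r + e, the family could be shifted down by r + e, and its
  supremum would have the negative radius -e.\<close>

lemma is_ball_sup_radius:
  assumes sup: "is_ball_sup D (x, r)" and e: "0 < e"
  shows "\<exists>(y, s)\<in>D. s < r + e"
proof (rule ccontr)
  assume no: "\<not> (\<exists>(y, s)\<in>D. s < r + e)"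
  have "D \<subseteq> formal_balls X" using sup unfolding directed_in_def by blast
  then have "shift_ball (- (r + e)) ` D \<subseteq> formal_balls X" using no by fastforce
  from is_ball_sup_shift[OF sup this] have "(x, r + - (r + e)) \<in> formal_balls X"
    unfolding is_sup_in_def by blast
  then show False using e by simp
qed

lemma way_below_balls:
  assumes "b \<in> formal_balls X"
  shows "is_ball_sup {c \<in> formal_balls X. c \<lless> b} b"
  using continuous_poset assms unfolding continuous_poset_on_def by blast

text \<open>For negative \<open>a\<close>, a family that tests the conclusion is shifted up. For
  \<open>a \<ge> 0\<close> a test family might have radii too small to be shifted down; instead the
  balls way below (x, r + a) are used, whose radii are all at least r + a. Shifted down by
  \<open>a\<close> they have supremum (x, r), so one of them lies above (y, s).\<close>

lemma way_below_shift:
  assumes yx: "(y, s) \<lless> (x, r)" and y: "(y, s) \<in> formal_balls X" and x: "(x, r) \<in> formal_balls X"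
    and a: "0 \<le> r + a"
  shows "(y, s + a) \<lless> (x, r + a)"
proof (cases "0 \<le> a")
  case True
  define D where "D = {b \<in> formal_balls X. b \<lless> (x, r + a)}"
  have sup: "is_ball_sup D (x, r + a)"
    unfolding D_def using x a by (intro way_below_balls) simp
  have "r + a \<le> t" if "(z, t) \<in> D" for z t
    using sup that unfolding is_sup_in_def ball_le_def by auto
  then have "shift_ball (- a) ` D \<subseteq> formal_balls X"
    using x unfolding D_def by fastforce
  from is_ball_sup_shift[OF sup this] have "is_ball_sup (shift_ball (- a) ` D) (x, r)" by simp
  moreover have "ball_le d (x, r) (x, r)"
    using poset x unfolding poset_on_def reflp_on_def by blast
  ultimately obtain c where c: "c \<in> D" "ball_le d (y, s) (shift_ball (- a) c)"
    using yx unfolding way_below_def by blast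
  have "ball_le d (y, s + a) c" using c(2) by (simp add: ball_le_shift_right)
  then show ?thesis
    using c(1) y True le_way_below_trans[OF poset, of "(y, s + a)" c] unfolding D_def by simp
next
  case False
  show ?thesis
    unfolding way_below_def
  proof (intro allI impI)
    fix D u
    assume D: "directed_in (formal_balls X) (ball_le d) D \<and>
      is_sup_in (formal_balls X) (ball_le d) D u \<and> ball_le d (x, r + a) u"
    obtain z t where u: "u = (z, t)" by fastforce
    have "is_ball_sup (shift_ball (- a) ` D) (z, t + - a)"
      using D False unfolding u by (intro is_ball_sup_shift_nonneg) auto
    moreover have "ball_le d (x, r) (z, t + - a)"
      using D unfolding u by (simp add: ball_le_def algebra_simps)
    ultimately obtain c where c: "c \<in> D" "ball_le d (y, s) (shift_ball (- a) c)"
      using yx unfolding way_below_def by blast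
    have "ball_le d (y, s + a) c" using c(2) by (simp add: ball_le_shift_right)
    then show "\<exists>c\<in>D. ball_le d (y, s + a) c" using c(1) by blast
  qed
qed

lemma way_below_is_ball_sup:
  assumes sup: "is_ball_sup D u" and b: "b \<in> formal_balls X" "b \<lless> u"
  shows "\<exists>c\<in>D. b \<lless> c"
proof -
  have "u \<in> formal_balls X" using sup unfolding is_sup_in_def by blast
  then show ?thesis
    using scott_open_way_above[OF continuous_poset b(1)] sup b(2) unfolding scott_open_def by blast
qed

lemma openin_way_above:
  assumes "b \<in> formal_balls X"
  shows "openin (d_scott_topology X d) {x \<in> X. b \<lless> (x, 0)}"
  unfolding d_scott_topology_def openin_pullback_topology
  using scott_open_way_above[OF continuous_poset assms]
  by (intro exI[of _ "{c \<in> formal_balls X. b \<lless> c}"]) auto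

end

section \<open>Lipschitz maps\<close>

lemma dR_le_add_iff: "dR u v \<le> c \<longleftrightarrow> u \<le> v + c"
  by (cases c) (simp_all add: dR_le_iff)

lemma Lip_iff:
  "f \<in> Lip X d \<alpha> \<longleftrightarrow> f \<in> extensional X \<and> (\<forall>x\<in>X. \<forall>y\<in>X. f x \<le> f y + ennreal \<alpha> * d x y)"
  unfolding Lip_def lipschitz_qm_def by (simp add: dR_le_add_iff)

lemma Lip_ball_le:
  assumes "f \<in> Lip X d \<alpha>" "0 \<le> \<alpha>" "x \<in> X" "y \<in> X" "ball_le d (x, r) (y, s)"
  shows "f x \<le> f y + ennreal (\<alpha> * (r - s))"
proof -
  have "f x \<le> f y + ennreal \<alpha> * d x y" using assms(1,3,4) unfolding Lip_iff by blast
  also have "\<dots> \<le> f y + ennreal \<alpha> * ennreal (r - s)"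
    using assms(5) by (intro add_left_mono mult_left_mono) (auto simp: ball_le_def)
  also have "\<dots> = f y + ennreal (\<alpha> * (r - s))"
    using assms(2,5) by (simp add: ball_le_def ennreal_mult)
  finally show ?thesis .
qed

text \<open>Each instance of the Lipschitz condition constrains two coordinates; addition on
  \<open>ennreal\<close> is continuous and the order is closed.\<close>

lemma closedin_ennreal_cube_le:
  assumes "x \<in> X" "y \<in> X"
  shows "closedin (ennreal_cube X) {f \<in> topspace (ennreal_cube X). f x \<le> f y + c}"
proof -
  have proj: "continuous_map (ennreal_cube X) euclidean (\<lambda>f. f z)" if "z \<in> X" for z
    using that by (rule continuous_map_product_projection)
  have "continuous_map (ennreal_cube X) euclidean (\<lambda>f. (f x, f y))"
    using continuous_map_pairedI[OF proj[OF assms(1)] proj[OF assms(2)]] by simp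
  moreover have "closed {p :: ennreal \<times> ennreal. fst p \<le> snd p + c}"
    by (intro closed_Collect_le continuous_intros)
  ultimately have "closedin (ennreal_cube X)
      {f \<in> topspace (ennreal_cube X). (f x, f y) \<in> {p. fst p \<le> snd p + c}}"
    by (intro closedin_continuous_map_preimage) auto
  then show ?thesis by simp
qed

lemma closedin_ennreal_cube_Lip: "closedin (ennreal_cube X) (Lip X d \<alpha>)"
proof -
  have "Lip X d \<alpha> = topspace (ennreal_cube X) \<inter> (\<Inter>x\<in>X. \<Inter>y\<in>X.
      topspace (ennreal_cube X) \<inter> {f \<in> topspace (ennreal_cube X). f x \<le> f y + ennreal \<alpha> * d x y})"
    by (auto simp: Lip_iff PiE_def)
  also have "closedin (ennreal_cube X) \<dots>"
    by (cases "X = {}")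
      (auto intro!: closedin_Int closedin_INT closedin_ennreal_cube_le simp del: topspace_product_topology)
  finally show ?thesis .
qed

lemma closedin_ennreal_cube_Lip_bdd: "closedin (ennreal_cube X) (Lip_bdd X d \<alpha> a)"
proof -
  have "Lip_bdd X d \<alpha> a = Lip X d \<alpha> \<inter> (\<Inter>x\<in>X.
      {f \<in> topspace (ennreal_cube X). f x \<in> {..ennreal (\<alpha> * a)}})"
    by (auto simp: Lip_bdd_def Lip_iff PiE_def)
  also have "closedin (ennreal_cube X) \<dots>"
    using closedin_ennreal_cube_Lip
    by (cases "X = {}")
      (auto intro!: closedin_Int closedin_INT closedin_ennreal_cube_vimage
        simp del: topspace_product_topology atMost_iff)
  finally show ?thesis .
qed

context continuous_quasi_metric
begin

text \<open>Reduces Scott continuity of the map on balls to an inequality between values. An upper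
  bound (v, t) of the images satisfies \<open>f y \<le> v + (\<alpha> s - t)\<close>, and the excess
  splits into \<open>\<alpha> (s - r)\<close>, which is subtracted in the supremum, and
  \<open>\<alpha> r - t\<close>.\<close>

lemma Lip_cont_if_le_SUP:
  assumes f: "f \<in> Lip X d \<alpha>" and \<alpha>: "0 \<le> \<alpha>"
    and le: "\<And>D x r. is_ball_sup D (x, r) \<Longrightarrow> f x \<le> (SUP (y, s)\<in>D. f y - ennreal (\<alpha> * (s - r)))"
  shows "f \<in> Lip_cont X d \<alpha>"
proof -
  have mono: "ball_le dR (f x, \<alpha> * r) (f y, \<alpha> * s)"
    if "x \<in> X" "y \<in> X" "ball_le d (x, r) (y, s)" for x y r s
  proof -
    have "s \<le> r" using that by (simp add: ball_le_def)
    then show ?thesis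
      using Lip_ball_le[OF f \<alpha> that] \<alpha>
      by (simp add: ball_le_def dR_le_iff mult_left_mono right_diff_distrib)
  qed
  have "is_sup_in (formal_balls UNIV) (ball_le dR) ((\<lambda>(x, r). (f x, \<alpha> * r)) ` D) (f x, \<alpha> * r)"
    if sup: "is_ball_sup D (x, r)" for D x r
    unfolding is_sup_in_def
  proof (intro conjI ballI impI)
    have x: "x \<in> X" "0 \<le> r" using sup unfolding is_sup_in_def by auto
    have D: "y \<in> X" "0 \<le> s" "r \<le> s" "ball_le d (y, s) (x, r)" if "(y, s) \<in> D" for y s
      using sup that unfolding is_sup_in_def directed_in_def ball_le_def by auto
    show "(f x, \<alpha> * r) \<in> formal_balls UNIV" using x \<alpha> by simp
    show "ball_le dR b (f x, \<alpha> * r)" if "b \<in> (\<lambda>(x, r). (f x, \<alpha> * r)) ` D" for b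
      using that D mono x by auto
    fix b assume b: "b \<in> formal_balls UNIV" and ub: "\<forall>c\<in>(\<lambda>(x, r). (f x, \<alpha> * r)) ` D. ball_le dR c b"
    obtain v t where vt: "b = (v, t)" by fastforce
    have ub': "t \<le> \<alpha> * s" "f y \<le> v + ennreal (\<alpha> * s - t)" if "(y, s) \<in> D" for y s
      using ub that unfolding vt by (auto simp: ball_le_def dR_le_iff dest!: bspec)
    \<comment> \<open>The radii of \<open>D\<close> come arbitrarily close to r, so the bounds
      \<open>t \<le> \<alpha> * s\<close> pass to the limit. The margin is divided by
      \<open>\<alpha>\<close>, hence the case distinction; for \<open>\<alpha> = 0\<close> any
      member of \<open>D\<close> suffices.\<close>
    have t: "t \<le> \<alpha> * r"
    proof (cases "\<alpha> = 0")
      case True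
      then show ?thesis using ub'(1) sup unfolding directed_in_def by fastforce
    next
      case False
      show ?thesis
      proof (rule ccontr)
        assume "\<not> t \<le> \<alpha> * r"
        then have "0 < (t - \<alpha> * r) / \<alpha>" using False \<alpha> by simp
        then obtain y s where ys: "(y, s) \<in> D" "s < r + (t - \<alpha> * r) / \<alpha>"
          using is_ball_sup_radius[OF sup] by blast
        then have "\<alpha> * s < \<alpha> * (r + (t - \<alpha> * r) / \<alpha>)" using False \<alpha> by simp
        also have "\<dots> = t" using False by (simp add: field_simps)
        finally show False using ub'(1)[OF ys(1)] by simp
      qed
    qed
    have "f x \<le> (SUP (y, s)\<in>D. f y - ennreal (\<alpha> * (s - r)))" using sup by (rule le)
    also have "\<dots> \<le> v + ennreal (\<alpha> * r - t)"
    proof (intro SUP_least, clarify)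
      fix y s assume ys: "(y, s) \<in> D"
      have "f y \<le> v + ennreal (\<alpha> * s - t)" using ys by (rule ub')
      also have "ennreal (\<alpha> * s - t) = ennreal (\<alpha> * (s - r)) + ennreal (\<alpha> * r - t)"
        using t \<alpha> D(3)[OF ys] by (simp add: right_diff_distrib mult_left_mono flip: ennreal_plus)
      finally show "f y - ennreal (\<alpha> * (s - r)) \<le> v + ennreal (\<alpha> * r - t)"
        by (simp add: ennreal_minus_le_iff ac_simps)
    qed
    finally show "ball_le dR (f x, \<alpha> * r) b" unfolding vt using t by (simp add: ball_le_def dR_le_iff)
  qed
  then have "scott_continuous (formal_balls X) (ball_le d) (formal_balls UNIV) (ball_le dR)
      (\<lambda>(x, r). (f x, \<alpha> * r))"
    unfolding scott_continuous_def monotone_on_def using mono \<alpha> by (auto simp: formal_balls_def)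
  then show ?thesis using f unfolding Lip_cont_def lipschitz_continuous_qm_def by blast
qed

text \<open>The ball with centre \<open>?S\<close> and radius \<open>\<alpha> * r\<close> bounds all
  images, so it lies above their supremum.\<close>

lemma Lip_cont_le_SUP:
  assumes f: "f \<in> Lip_cont X d \<alpha>" and \<alpha>: "0 \<le> \<alpha>" and sup: "is_ball_sup D (x, r)"
  shows "f x \<le> (SUP (y, s)\<in>D. f y - ennreal (\<alpha> * (s - r)))" (is "_ \<le> ?S")
proof -
  have r: "0 \<le> r" and le: "r \<le> s" if "(y, s) \<in> D" for y s
    using sup that unfolding is_sup_in_def directed_in_def ball_le_def by auto
  have lc: "lipschitz_continuous_qm X d UNIV dR \<alpha> f" using f unfolding Lip_cont_def by blast
  have sup': "is_sup_in (formal_balls UNIV) (ball_le dR) ((\<lambda>(x, r). (f x, \<alpha> * r)) ` D) (f x, \<alpha> * r)"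
    using sup by (intro lipschitz_continuous_qmD(3)[OF lc]) auto
  have "ball_le dR (f y, \<alpha> * s) (?S, \<alpha> * r)" if ys: "(y, s) \<in> D" for y s
  proof -
    have "f y - ennreal (\<alpha> * (s - r)) \<le> ?S" using ys by (intro SUP_upper2[OF ys]) auto
    then show ?thesis
      using le[OF ys] \<alpha>
      by (simp add: ball_le_def dR_le_iff ennreal_minus_le_iff mult_left_mono right_diff_distrib add.commute)
  qed
  then have "\<forall>c\<in>(\<lambda>(x, r). (f x, \<alpha> * r)) ` D. ball_le dR c (?S, \<alpha> * r)" by auto
  moreover have "(?S, \<alpha> * r) \<in> formal_balls UNIV" using sup' unfolding is_sup_in_def by auto
  ultimately have "ball_le dR (f x, \<alpha> * r) (?S, \<alpha> * r)"
    using sup' unfolding is_sup_in_def by blast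
  then show ?thesis by (simp add: ball_le_def dR_le_iff flip: zero_ennreal_def)
qed

section \<open>The envelope as a supremum over way-below balls\<close>

definition lip_env :: "real \<Rightarrow> ('a \<Rightarrow> ennreal) \<Rightarrow> 'a \<Rightarrow> ennreal" where
  "lip_env \<alpha> f =
    (\<lambda>x\<in>X. SUP (y, s)\<in>{b \<in> formal_balls X. b \<lless> (x, 0)}. f y - ennreal (\<alpha> * s))"

lemma lip_env_upper:
  assumes "x \<in> X" "y \<in> X" "0 \<le> s" "(y, s) \<lless> (x, 0)"
  shows "f y - ennreal (\<alpha> * s) \<le> lip_env \<alpha> f x"
proof -
  have "(y, s) \<in> {b \<in> formal_balls X. b \<lless> (x, 0)}" using assms by simp
  from SUP_upper[OF this, of "\<lambda>(y, s). f y - ennreal (\<alpha> * s)"] show ?thesis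
    unfolding lip_env_def using assms(1) by simp
qed

lemma lip_env_least:
  assumes "x \<in> X" "\<And>y s. \<lbrakk>y \<in> X; 0 \<le> s; (y, s) \<lless> (x, 0)\<rbrakk> \<Longrightarrow> f y - ennreal (\<alpha> * s) \<le> v"
  shows "lip_env \<alpha> f x \<le> v"
  unfolding lip_env_def using assms by (auto intro!: SUP_least)

text \<open>Turns a lower bound on the envelope into a single lower bound on \<open>f\<close> at one
  point. This makes the envelope continuous in \<open>f\<close> and supplies the step maps.\<close>

lemma less_lip_env_iff:
  assumes "x \<in> X"
  shows "q < lip_env \<alpha> f x \<longleftrightarrow>
    (\<exists>y s. y \<in> X \<and> 0 \<le> s \<and> (y, s) \<lless> (x, 0) \<and> q + ennreal (\<alpha> * s) < f y)"
  unfolding lip_env_def using assms by (auto simp: less_SUP_iff less_diff_eq_ennreal)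

lemma lip_env_le:
  assumes f: "f \<in> Lip X d \<alpha>" and \<alpha>: "0 \<le> \<alpha>" and x: "x \<in> X"
  shows "lip_env \<alpha> f x \<le> f x"
proof (rule lip_env_least[OF x])
  fix y s assume ys: "y \<in> X" "0 \<le> s" "(y, s) \<lless> (x, 0)"
  then have "ball_le d (y, s) (x, 0)" using way_below_imp_le[OF poset _ ys(3)] x by simp
  then have "f y \<le> f x + ennreal (\<alpha> * s)" using Lip_ball_le[OF f \<alpha> ys(1) x] by force
  then show "f y - ennreal (\<alpha> * s) \<le> f x" by (simp add: ennreal_minus_le_iff add.commute)
qed

text \<open>At finite distance c, a ball (z, s) way below (x, 0) becomes (z, s + c), way below (x,
  c) and hence way below (y, 0); the extra cost is \<open>\<alpha> c\<close>.\<close>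

lemma lip_env_Lip:
  assumes f: "f \<in> Lip X d \<alpha>" and \<alpha>: "0 \<le> \<alpha>"
  shows "lip_env \<alpha> f \<in> Lip X d \<alpha>"
  unfolding Lip_iff
proof (intro conjI ballI)
  show "lip_env \<alpha> f \<in> extensional X" unfolding lip_env_def by simp
  fix x y assume x: "x \<in> X" and y: "y \<in> X"
  show "lip_env \<alpha> f x \<le> lip_env \<alpha> f y + ennreal \<alpha> * d x y"
  proof (cases "d x y")
    case (real c)
    show ?thesis
    proof (rule lip_env_least[OF x])
      fix z s assume z: "z \<in> X" "0 \<le> s" "(z, s) \<lless> (x, 0)"
      have "(z, s + c) \<lless> (x, 0 + c)" using z x real by (intro way_below_shift) auto
      moreover have "ball_le d (x, 0 + c) (y, 0)" using real by (simp add: ball_le_def)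
      ultimately have "(z, s + c) \<lless> (y, 0)"
        using way_below_le_trans[OF poset] x y real(1) by simp
      then have "f z - ennreal (\<alpha> * (s + c)) \<le> lip_env \<alpha> f y"
        using lip_env_upper[OF y z(1)] z(2) real(1) by simp
      moreover have "ennreal (\<alpha> * (s + c)) = ennreal (\<alpha> * s) + ennreal (\<alpha> * c)"
        using z \<alpha> real(1) by (simp add: distrib_left)
      ultimately show "f z - ennreal (\<alpha> * s) \<le> lip_env \<alpha> f y + ennreal \<alpha> * d x y"
        using real \<alpha> by (simp add: ennreal_minus_le_iff ennreal_mult ac_simps)
    qed
  next
    case top
    show ?thesis
    proof (cases "\<alpha> = 0")
      case True
      \<comment> \<open>As 0 times infinity is 0, the distance term vanishes and \<open>f\<close> is
        constant on \<open>X\<close>. A single ball way below (y, 0) already attains the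
        constant.\<close>
      obtain z s where z: "z \<in> X" "0 \<le> s" "(z, s) \<lless> (y, 0)"
        using way_below_balls[of "(y, 0)"] y unfolding directed_in_def by fastforce
      have "lip_env \<alpha> f x \<le> f x" by (rule lip_env_le[OF f \<alpha> x])
      also have "\<dots> \<le> f z" using f x z(1) unfolding Lip_iff True by fastforce
      also have "\<dots> \<le> lip_env \<alpha> f y"
        using lip_env_upper[OF y z, of f \<alpha>] unfolding True by simp
      finally show ?thesis by (simp add: True)
    next
      case False
      then show ?thesis using top \<alpha> by (simp add: ennreal_mult_top)
    qed
  qed
qed

text \<open>A ball (y, s) way below (x, 0) is shifted up by r, compared with a member (z, t) of
  \<open>D\<close> by Scott openness, and shifted down by t to be way below (z, 0). The cost
  \<open>\<alpha> s\<close> splits into \<open>\<alpha> (s + r - t)\<close>, paid in the envelope at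
  z, and \<open>\<alpha> (t - r)\<close>.\<close>

lemma lip_env_Lip_cont:
  assumes f: "f \<in> Lip X d \<alpha>" and \<alpha>: "0 \<le> \<alpha>"
  shows "lip_env \<alpha> f \<in> Lip_cont X d \<alpha>"
proof (rule Lip_cont_if_le_SUP[OF lip_env_Lip[OF f \<alpha>] \<alpha>])
  fix D x r assume sup: "is_ball_sup D (x, r)"
  then have x: "x \<in> X" "0 \<le> r" unfolding is_sup_in_def by auto
  show "lip_env \<alpha> f x \<le> (SUP (y, s)\<in>D. lip_env \<alpha> f y - ennreal (\<alpha> * (s - r)))" (is "_ \<le> ?S")
  proof (rule lip_env_least[OF x(1)])
    fix y s assume y: "y \<in> X" "0 \<le> s" "(y, s) \<lless> (x, 0)"
    have "(y, s + r) \<lless> (x, 0 + r)" using y x by (intro way_below_shift) auto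
    then have "\<exists>c\<in>D. (y, s + r) \<lless> c"
      using y x by (intro way_below_is_ball_sup[OF sup]) auto
    then obtain z t where z: "(z, t) \<in> D" "(y, s + r) \<lless> (z, t)" by auto
    have t: "z \<in> X" "0 \<le> t" "r \<le> t"
      using sup z(1) unfolding is_sup_in_def directed_in_def ball_le_def by auto
    have "ball_le d (y, s + r) (z, t)" using way_below_imp_le[OF poset _ z(2)] t by simp
    then have st: "t \<le> s + r" by (simp add: ball_le_def)
    have "(y, s + r + - t) \<lless> (z, t + - t)" using z(2) y x t by (intro way_below_shift) auto
    then have "f y - ennreal (\<alpha> * (s + r - t)) \<le> lip_env \<alpha> f z"
      using lip_env_upper[OF t(1) y(1)] st by simp
    moreover have "\<alpha> * s = \<alpha> * (s + r - t) + \<alpha> * (t - r)" by (simp add: algebra_simps)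
    then have "ennreal (\<alpha> * s) = ennreal (\<alpha> * (s + r - t)) + ennreal (\<alpha> * (t - r))"
      using st t \<alpha> by (simp flip: ennreal_plus)
    ultimately have "f y - ennreal (\<alpha> * s) \<le> lip_env \<alpha> f z - ennreal (\<alpha> * (t - r))"
      by (simp add: diff_add_eq_diff_diff_swap_ennreal ennreal_minus_mono)
    also have "\<dots> \<le> ?S" by (intro SUP_upper2[OF z(1)]) auto
    finally show "f y - ennreal (\<alpha> * s) \<le> ?S" .
  qed
qed

text \<open>Maximality: since (x, 0) is the supremum of the balls way below it, \<open>h x\<close>
  is recovered from the values of \<open>h\<close> at their centres, where \<open>f\<close>
  dominates \<open>h\<close>.\<close>

lemma Lip_cont_le_lip_env:
  assumes h: "h \<in> Lip_cont X d \<alpha>" and \<alpha>: "0 \<le> \<alpha>" and le: "pointwise_le X h f" and x: "x \<in> X"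
  shows "h x \<le> lip_env \<alpha> f x"
proof -
  have "h x \<le> (SUP (y, s)\<in>{b \<in> formal_balls X. b \<lless> (x, 0)}. h y - ennreal (\<alpha> * (s - 0)))"
    using x by (intro Lip_cont_le_SUP[OF h \<alpha>] way_below_balls) simp
  also have "\<dots> \<le> lip_env \<alpha> f x"
  proof (intro SUP_least, clarify)
    fix y s assume ys: "(y, s) \<in> formal_balls X" "(y, s) \<lless> (x, 0)"
    then have "h y - ennreal (\<alpha> * (s - 0)) \<le> f y - ennreal (\<alpha> * s)"
      using le unfolding pointwise_le_def by (simp add: ennreal_minus_mono)
    also have "\<dots> \<le> lip_env \<alpha> f x" using ys x by (intro lip_env_upper) auto
    finally show "h y - ennreal (\<alpha> * (s - 0)) \<le> lip_env \<alpha> f x" .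
  qed
  finally show ?thesis .
qed

lemma lip_env_eq_Lip_cont:
  assumes f: "f \<in> Lip_cont X d \<alpha>" and \<alpha>: "0 \<le> \<alpha>"
  shows "lip_env \<alpha> f = f"
proof (rule extensionalityI[of _ X])
  have L: "f \<in> Lip X d \<alpha>" using f unfolding Lip_cont_def by blast
  then show "f \<in> extensional X" unfolding Lip_iff by blast
  show "lip_env \<alpha> f \<in> extensional X" unfolding lip_env_def by simp
  show "lip_env \<alpha> f x = f x" if "x \<in> X" for x
    using lip_env_le[OF L \<alpha> that] Lip_cont_le_lip_env[OF f \<alpha> _ that, of f]
    by (simp add: pointwise_le_def)
qed

lemma Lip_envelope_eq_lip_env:
  assumes f: "f \<in> Lip X d \<alpha>" and \<alpha>: "0 \<le> \<alpha>"
  shows "Lip_envelope X d \<alpha> f = lip_env \<alpha> f"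
  unfolding Lip_envelope_def
proof (rule the_equality)
  show env: "lip_env \<alpha> f \<in> Lip_cont X d \<alpha> \<and> pointwise_le X (lip_env \<alpha> f) f \<and>
      (\<forall>h\<in>Lip_cont X d \<alpha>. pointwise_le X h f \<longrightarrow> pointwise_le X h (lip_env \<alpha> f))"
    using lip_env_Lip_cont[OF f \<alpha>] lip_env_le[OF f \<alpha>] Lip_cont_le_lip_env[OF _ \<alpha>, of _ f]
    by (simp add: pointwise_le_def)
  fix g assume g: "g \<in> Lip_cont X d \<alpha> \<and> pointwise_le X g f \<and>
      (\<forall>h\<in>Lip_cont X d \<alpha>. pointwise_le X h f \<longrightarrow> pointwise_le X h g)"
  show "g = lip_env \<alpha> f"
  proof (rule extensionalityI[of _ X])
    show "g \<in> extensional X" using g unfolding Lip_cont_def Lip_iff by blast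
    show "lip_env \<alpha> f \<in> extensional X" unfolding lip_env_def by simp
    have "pointwise_le X g (lip_env \<alpha> f)" "pointwise_le X (lip_env \<alpha> f) g" using g env by blast+
    then show "g x = lip_env \<alpha> f x" if "x \<in> X" for x
      using that unfolding pointwise_le_def by (simp add: order_antisym)
  qed
qed

text \<open>Formulated for any set of Lipschitz maps stable under the envelope, so that the bounded
  and unbounded cases are instances.\<close>

lemma retraction_Lip_envelope:
  assumes \<alpha>: "0 \<le> \<alpha>" and F: "F \<subseteq> Lip X d \<alpha>" and env: "\<And>f. f \<in> F \<Longrightarrow> lip_env \<alpha> f \<in> F"
  shows "retraction_maps (pointwise_topology X F) (pointwise_topology X (F \<inter> Lip_cont X d \<alpha>))
    (Lip_envelope X d \<alpha>) (\<lambda>f. f)"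
  unfolding retraction_maps_def
proof (intro conjI ballI)
  have eq: "Lip_envelope X d \<alpha> f = lip_env \<alpha> f" if "f \<in> F" for f
    using F that by (intro Lip_envelope_eq_lip_env \<alpha>) blast
  show "continuous_map (pointwise_topology X F) (pointwise_topology X (F \<inter> Lip_cont X d \<alpha>))
      (Lip_envelope X d \<alpha>)"
  proof (rule continuous_map_into_pointwise)
    show "Lip_envelope X d \<alpha> \<in> topspace (pointwise_topology X F) \<rightarrow> F \<inter> Lip_cont X d \<alpha>"
      using eq env F lip_env_Lip_cont[OF _ \<alpha>] by auto
    fix x q assume x: "x \<in> X"
    have "{f \<in> F. q < Lip_envelope X d \<alpha> f x} =
      (\<Union>(y, s)\<in>{b \<in> formal_balls X. b \<lless> (x, 0)}. {f \<in> F. q + ennreal (\<alpha> * s) < f y})"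
      by (force simp: eq less_lip_env_iff[OF x])
    moreover have "openin (pointwise_topology X F) \<dots>"
      by (intro openin_clauses(3)) (auto intro: openin_pointwise_less)
    ultimately show "openin (pointwise_topology X F)
        {f \<in> topspace (pointwise_topology X F). q < Lip_envelope X d \<alpha> f x}"
      by simp
  qed
  show "continuous_map (pointwise_topology X (F \<inter> Lip_cont X d \<alpha>)) (pointwise_topology X F) (\<lambda>f. f)"
    by (rule continuous_map_into_pointwise)
      (auto simp only: topspace_pointwise_topology intro: openin_pointwise_less)
  show "Lip_envelope X d \<alpha> f = f" if "f \<in> topspace (pointwise_topology X (F \<inter> Lip_cont X d \<alpha>))" for f
    using that eq lip_env_eq_Lip_cont[OF _ \<alpha>] by simp
qed

section \<open>Step maps and the Scott topology on lower semicontinuous maps\<close>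

definition step_map :: "(('a \<times> real) \<times> ennreal) set \<Rightarrow> 'a \<Rightarrow> ennreal" where
  "step_map E = (\<lambda>x\<in>X. SUP (b, q)\<in>{e \<in> E. fst e \<lless> (x, 0)}. q)"

lemma less_step_map_iff:
  "x \<in> X \<Longrightarrow> q < step_map E x \<longleftrightarrow> (\<exists>b p. (b, p) \<in> E \<and> b \<lless> (x, 0) \<and> q < p)"
  unfolding step_map_def by (auto simp: less_SUP_iff)

lemma step_map_LSC:
  assumes "E \<subseteq> formal_balls X \<times> UNIV"
  shows "step_map E \<in> LSC X d"
proof -
  have "openin (d_scott_topology X d) {x \<in> X. r < step_map E x}" for r
  proof -
    have "{x \<in> X. r < step_map E x} = (\<Union>(b, q)\<in>{e \<in> E. r < snd e}. {x \<in> X. b \<lless> (x, 0)})"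
      by (force simp: less_step_map_iff)
    moreover have "openin (d_scott_topology X d) \<dots>"
      using assms by (intro openin_clauses(3)) (auto intro!: openin_way_above)
    ultimately show ?thesis by simp
  qed
  then show ?thesis unfolding LSC_def step_map_def by simp
qed

text \<open>Where a step takes the value q at x, its ball lies below (x, 0), so h loses at most
  \<open>\<alpha> s\<close> between y and x. For finite \<open>E\<close> the assumption is a
  pointwise-open condition on \<open>h\<close>.\<close>

lemma step_map_le_Lip:
  assumes h: "h \<in> Lip X d \<alpha>" and \<alpha>: "0 \<le> \<alpha>"
    and E: "\<And>y s q. ((y, s), q) \<in> E \<Longrightarrow> (y, s) \<in> formal_balls X \<and> q + ennreal (\<alpha> * s) < h y"
  shows "pointwise_le X (step_map E) h"
  unfolding pointwise_le_def
proof
  fix x assume x: "x \<in> X"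
  have "q \<le> h x" if e: "((y, s), q) \<in> E" "(y, s) \<lless> (x, 0)" for y s q
  proof -
    have y: "y \<in> X" "0 \<le> s" "q + ennreal (\<alpha> * s) < h y" using E[OF e(1)] by auto
    have "ball_le d (y, s) (x, 0)" using way_below_imp_le[OF poset _ e(2)] x by simp
    then have "h y \<le> h x + ennreal (\<alpha> * s)" using Lip_ball_le[OF h \<alpha> y(1) x] by force
    with y(3) have "q + ennreal (\<alpha> * s) < h x + ennreal (\<alpha> * s)" by (rule less_le_trans)
    then show ?thesis by (meson add_right_mono linorder_not_le nle_le)
  qed
  then show "step_map E x \<le> h x" unfolding step_map_def using x by (auto intro!: SUP_least)
qed

text \<open>The step maps of finite sets of data strictly below \<open>f\<close> are directed by
  union and have supremum \<open>f\<close>, so a Scott-open set containing \<open>f\<close> contains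
  one of them.\<close>

lemma LSC_scott_neighbourhood:
  assumes W: "scott_open (LSC X d) (pointwise_le X) W" and fW: "f \<in> W"
    and f: "f \<in> Lip_cont X d \<alpha>" and \<alpha>: "0 \<le> \<alpha>"
  obtains E where "finite E" "step_map E \<in> W"
    "\<And>y s q. ((y, s), q) \<in> E \<Longrightarrow> (y, s) \<in> formal_balls X \<and> q + ennreal (\<alpha> * s) < f y"
proof -
  define T where "T = {((y, s), q). (y, s) \<in> formal_balls X \<and> q + ennreal (\<alpha> * s) < f y}"
  define D where "D = step_map ` {E. finite E \<and> E \<subseteq> T}"
  have L: "f \<in> Lip X d \<alpha>" using f unfolding Lip_cont_def by blast
  have "directed_in (LSC X d) (pointwise_le X) D"
    unfolding directed_in_def
  proof (intro conjI ballI)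
    show "D \<subseteq> LSC X d" unfolding D_def T_def by (auto intro!: step_map_LSC)
    show "D \<noteq> {}" unfolding D_def by blast
    fix g h assume "g \<in> D" "h \<in> D"
    then obtain A B where AB: "finite A" "A \<subseteq> T" "finite B" "B \<subseteq> T" "g = step_map A" "h = step_map B"
      unfolding D_def by blast
    then have "step_map (A \<union> B) \<in> D" unfolding D_def by blast
    moreover have "pointwise_le X g (step_map (A \<union> B))" "pointwise_le X h (step_map (A \<union> B))"
      unfolding AB pointwise_le_def step_map_def by (auto intro!: SUP_subset_mono)
    ultimately show "\<exists>k\<in>D. pointwise_le X g k \<and> pointwise_le X h k" by blast
  qed
  moreover have "is_sup_in (LSC X d) (pointwise_le X) D f"
    unfolding is_sup_in_def
  proof (intro conjI ballI impI)
    show "f \<in> LSC X d" using f Lip_cont_subset_LSC[OF \<alpha>] by blast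
    show "pointwise_le X g f" if "g \<in> D" for g
      using that unfolding D_def T_def by (auto intro!: step_map_le_Lip[OF L \<alpha>])
    fix v assume v: "\<forall>g\<in>D. pointwise_le X g v"
    have "f x \<le> v x" if x: "x \<in> X" for x
    proof (rule dense_le)
      fix q assume q: "q < f x"
      \<comment> \<open>As \<open>f\<close> is its own envelope, \<open>p < f x\<close> is witnessed
        by a ball way below (x, 0), and the one-step map of height p exceeds q at x.\<close>
      obtain p where p: "q < p" "p < f x" using dense[OF q] by blast
      then have "p < lip_env \<alpha> f x" using lip_env_eq_Lip_cont[OF f \<alpha>] by simp
      then obtain y s where ys: "y \<in> X" "0 \<le> s" "(y, s) \<lless> (x, 0)" "p + ennreal (\<alpha> * s) < f y"
        using less_lip_env_iff[OF x] by blast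
      then have "step_map {((y, s), p)} \<in> D" unfolding D_def T_def by auto
      then have "step_map {((y, s), p)} x \<le> v x" using v x unfolding pointwise_le_def by blast
      moreover have "q < step_map {((y, s), p)} x" using ys p(1) x by (simp add: less_step_map_iff)
      ultimately show "q \<le> v x" by simp
    qed
    then show "pointwise_le X f v" unfolding pointwise_le_def by blast
  qed
  ultimately obtain g where "g \<in> D" "g \<in> W" using W fW unfolding scott_open_def by blast
  then obtain E where "finite E" "E \<subseteq> T" "step_map E \<in> W" unfolding D_def by blast
  then show ?thesis by (intro that[of E]) (auto simp: T_def)
qed

text \<open>The pointwise supremum of lower semicontinuous maps is lower semicontinuous, so the
  supremum u of \<open>D\<close> cannot exceed it at x.\<close>

lemma scott_open_LSC_less:
  assumes x: "x \<in> X"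
  shows "scott_open (LSC X d) (pointwise_le X) {f \<in> LSC X d. q < f x}"
  unfolding scott_open_def
proof (intro conjI ballI allI impI)
  fix f g assume fg: "f \<in> {f \<in> LSC X d. q < f x}" "g \<in> LSC X d" "pointwise_le X f g"
  then have "q < f x" "f x \<le> g x" using x unfolding pointwise_le_def by auto
  then have "q < g x" by (rule less_le_trans)
  then show "g \<in> {f \<in> LSC X d. q < f x}" using fg by blast
next
  fix D u assume D: "directed_in (LSC X d) (pointwise_le X) D \<and>
    is_sup_in (LSC X d) (pointwise_le X) D u \<and> u \<in> {f \<in> LSC X d. q < f x}"
  define m where "m = (\<lambda>x\<in>X. SUP f\<in>D. f x)"
  have "openin (d_scott_topology X d) {x \<in> X. r < m x}" for r
  proof -
    have "{x \<in> X. r < m x} = (\<Union>f\<in>D. {x \<in> X. r < f x})"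
      unfolding m_def by (auto simp: less_SUP_iff)
    moreover have "openin (d_scott_topology X d) \<dots>"
      using D unfolding directed_in_def LSC_def by (intro openin_clauses(3)) auto
    ultimately show ?thesis by simp
  qed
  then have "m \<in> LSC X d" unfolding LSC_def m_def by simp
  moreover have "\<forall>f\<in>D. pointwise_le X f m"
    unfolding pointwise_le_def m_def by (auto intro: SUP_upper)
  ultimately have "pointwise_le X u m" using D unfolding is_sup_in_def by blast
  then have "u x \<le> m x" using x unfolding pointwise_le_def by blast
  moreover have "q < u x" using D by blast
  ultimately have "q < m x" by simp
  then obtain f where "f \<in> D" "q < f x" using x unfolding m_def by (auto simp: less_SUP_iff)
  then show "D \<inter> {f \<in> LSC X d. q < f x} \<noteq> {}" using D unfolding directed_in_def by blast
qed blast

lemma subtopology_LSC_scott: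
  assumes \<alpha>: "0 \<le> \<alpha>" and G: "G \<subseteq> Lip_cont X d \<alpha>"
  shows "subtopology (LSC_scott X d) G = pointwise_topology X G"
proof (rule topology_eq[THEN iffD2], intro allI iffI)
  have GL: "G \<subseteq> LSC X d" using G Lip_cont_subset_LSC[OF \<alpha>] by blast
  then have top: "topspace (subtopology (LSC_scott X d) G) = G"
    unfolding LSC_scott_def by (simp add: Int_absorb1)
  fix U
  show "openin (subtopology (LSC_scott X d) G) U" if U: "openin (pointwise_topology X G) U"
  proof -
    have cont: "continuous_map (subtopology (LSC_scott X d) G) (pointwise_topology X G) (\<lambda>f. f)"
    proof (rule continuous_map_into_pointwise)
      fix x q assume "x \<in> X"
      then have "openin (LSC_scott X d) {f \<in> LSC X d. q < f x}"
        unfolding LSC_scott_def by (simp add: scott_open_LSC_less)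
      moreover have "{f \<in> G. q < f x} = {f \<in> LSC X d. q < f x} \<inter> G" using GL by blast
      ultimately show "openin (subtopology (LSC_scott X d) G)
          {f \<in> topspace (subtopology (LSC_scott X d) G). q < f x}"
        unfolding top openin_subtopology by blast
    qed (simp add: top)
    have "{f \<in> G. f \<in> U} = U" using openin_subset[OF U] by auto
    then show ?thesis using openin_continuous_map_preimage[OF cont U] by (simp only: top)
  qed
  show "openin (pointwise_topology X G) U" if U: "openin (subtopology (LSC_scott X d) G) U"
  proof -
    obtain W where W: "scott_open (LSC X d) (pointwise_le X) W" "U = W \<inter> G"
      using U unfolding openin_subtopology LSC_scott_def by auto
    have "\<exists>N. openin (pointwise_topology X G) N \<and> f \<in> N \<and> N \<subseteq> U" if f: "f \<in> U" for f
    proof -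
      have fW: "f \<in> W" "f \<in> G" "f \<in> Lip_cont X d \<alpha>" using f W(2) G by auto
      obtain E where E: "finite E" "step_map E \<in> W"
        "\<And>y s q. ((y, s), q) \<in> E \<Longrightarrow> (y, s) \<in> formal_balls X \<and> q + ennreal (\<alpha> * s) < f y"
        by (rule LSC_scott_neighbourhood[OF W(1) fW(1,3) \<alpha>]) blast
      \<comment> \<open>The finitely many strict inequalities that put the step map below
        \<open>f\<close> define a pointwise neighbourhood. Each \<open>h\<close> in it dominates the
        same step map, so it lies in the upward closed set \<open>W\<close>.\<close>
      define N where "N = G \<inter> \<Inter>((\<lambda>((y, s), q). {h \<in> G. q + ennreal (\<alpha> * s) < h y}) ` E)"
      have openG: "openin (pointwise_topology X G) G"
        using openin_topspace[of "pointwise_topology X G"] by simp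
      have "openin (pointwise_topology X G) V"
        if "V \<in> (\<lambda>((y, s), q). {h \<in> G. q + ennreal (\<alpha> * s) < h y}) ` E" for V
        using that E(3) by (auto intro!: openin_pointwise_less)
      then have "openin (pointwise_topology X G) N"
        unfolding N_def using E(1) openG by (intro openin_Int_Inter) auto
      moreover have "f \<in> N" unfolding N_def using E(3) fW by auto
      moreover have "N \<subseteq> U"
      proof
        fix h assume h: "h \<in> N"
        then have hG: "h \<in> G" unfolding N_def by blast
        have less: "q + ennreal (\<alpha> * s) < h y" if "((y, s), q) \<in> E" for y s q
          using h that unfolding N_def by fastforce
        have "h \<in> Lip X d \<alpha>" using hG G unfolding Lip_cont_def by blast
        then have "pointwise_le X (step_map E) h"
          by (rule step_map_le_Lip[OF _ \<alpha>]) (simp add: E(3) less del: mem_formal_balls)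
        then have "h \<in> W" using W(1) E(2) hG GL unfolding scott_open_def by blast
        then show "h \<in> U" using W(2) hG by blast
      qed
      ultimately show ?thesis by blast
    qed
    then show ?thesis by (subst openin_subopen) blast
  qed
qed

end

theorem lemma8p4:
  fixes X :: "'a set" and d :: "'a \<Rightarrow> 'a \<Rightarrow> ennreal" and \<alpha> a :: real
  assumes "quasi_metric_on X d" and "continuous_qms X d" and "0 \<le> \<alpha>" and "0 < a"
  shows
    "(continuous_map (pointwise_topology X (Lip X d \<alpha>)) (pointwise_topology X (Lip_cont X d \<alpha>))
        (Lip_envelope X d \<alpha>) \<and>
      continuous_map (pointwise_topology X (Lip_bdd X d \<alpha> a))
        (pointwise_topology X (Lip_cont_bdd X d \<alpha> a)) (Lip_envelope X d \<alpha>)) \<and>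
     (retraction_maps (pointwise_topology X (Lip X d \<alpha>)) (pointwise_topology X (Lip_cont X d \<alpha>))
        (Lip_envelope X d \<alpha>) (\<lambda>f. f) \<and>
      retraction_maps (pointwise_topology X (Lip_bdd X d \<alpha> a))
        (pointwise_topology X (Lip_cont_bdd X d \<alpha> a)) (Lip_envelope X d \<alpha>) (\<lambda>f. f)) \<and>
     (stably_compact_space (pointwise_topology X (Lip_cont X d \<alpha>)) \<and>
      stably_compact_space (pointwise_topology X (Lip_cont_bdd X d \<alpha> a))) \<and>
     (Yoneda_complete X d \<longrightarrow>
      stably_compact_space (subtopology (LSC_scott X d) (Lip_cont X d \<alpha>)) \<and>
      stably_compact_space (subtopology (LSC_scott X d) (Lip_cont_bdd X d \<alpha> a)))"
proof -
  interpret continuous_quasi_metric X d using assms(1,2) by unfold_locales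
  have cont: "Lip X d \<alpha> \<inter> Lip_cont X d \<alpha> = Lip_cont X d \<alpha>"
    "Lip_bdd X d \<alpha> a \<inter> Lip_cont X d \<alpha> = Lip_cont_bdd X d \<alpha> a"
    by (auto simp: Lip_cont_def Lip_bdd_def Lip_cont_bdd_def)
  \<comment> \<open>The bound is inherited because the envelope lies below \<open>f\<close>.\<close>
  have "lip_env \<alpha> f \<in> Lip_bdd X d \<alpha> a" if "f \<in> Lip_bdd X d \<alpha> a" for f
    using that lip_env_Lip[OF _ assms(3)] lip_env_le[OF _ assms(3)]
    unfolding Lip_bdd_def by (blast intro: order_trans)
  then have ret: "retraction_maps (pointwise_topology X (Lip X d \<alpha>))
      (pointwise_topology X (Lip_cont X d \<alpha>)) (Lip_envelope X d \<alpha>) (\<lambda>f. f)"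
    "retraction_maps (pointwise_topology X (Lip_bdd X d \<alpha> a))
      (pointwise_topology X (Lip_cont_bdd X d \<alpha> a)) (Lip_envelope X d \<alpha>) (\<lambda>f. f)"
    using retraction_Lip_envelope[OF assms(3), of "Lip X d \<alpha>"] lip_env_Lip[OF _ assms(3)]
      retraction_Lip_envelope[OF assms(3), of "Lip_bdd X d \<alpha> a"]
    unfolding cont by (auto simp: Lip_bdd_def)
  have stable: "stably_compact_space (pointwise_topology X (Lip_cont X d \<alpha>))"
    "stably_compact_space (pointwise_topology X (Lip_cont_bdd X d \<alpha> a))"
    using ret closedin_ennreal_cube_Lip closedin_ennreal_cube_Lip_bdd
    by (blast intro: stably_compact_space_retraction stably_compact_space_pointwise)+
  have "subtopology (LSC_scott X d) (Lip_cont X d \<alpha>) = pointwise_topology X (Lip_cont X d \<alpha>)"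
    "subtopology (LSC_scott X d) (Lip_cont_bdd X d \<alpha> a) = pointwise_topology X (Lip_cont_bdd X d \<alpha> a)"
    by (rule subtopology_LSC_scott[OF assms(3)]; auto simp: Lip_cont_bdd_def)+
  with ret stable show ?thesis by (simp add: retraction_maps_def)
qed

end
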